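(* Let $k$ be a field and $n\ge3$. For every $i$ with $0\le i\le n-1$ and every $g\in G_{\mathbf s,\mathbf t}$: (i) $L_{\mathbf s}\cap K(u_i^g)=L_{\mathbf t}\cap K(u_i^g)=K$; (ii) $L_{\mathbf s}L_{\mathbf t}=L_{\mathbf s}(u_i^g)=L_{\mathbf t}(u_i^g)$.
   Context: Let $x_1,\ldots,x_n,y_1,\ldots,y_n$ be independent variables over $k$; let $s_i$ (resp. $t_i$) be the $i$-th elementary symmetric function of $\mathbf x=(x_1,\ldots,x_n)$ (resp. $\mathbf y=(y_1,\ldots,y_n)$). Put $K=k(s_1,\ldots,s_n,t_1,\ldots,t_n)$, $L_{\mathbf s}=K(x_1,\ldots,x_n)$, $L_{\mathbf t}=K(y_1,\ldots,y_n)$, so $L_{\mathbf s}L_{\mathbf t}=k(\mathbf x,\mathbf y)$. Let $G_{\mathbf s,\mathbf t}=\mathrm{Gal}(k(\mathbf x,\mathbf y)/K)\cong\mathfrak S_n\times\mathfrak S_n$, which acts (on the right, $a\mapsto a^g$) by permuting the $x_i$ and, independently, the $y_i$. Define $u_0,\ldots,u_{n-1}\in k(\mathbf x,\mathbf y)$ as the unique solution of the system $y_i=u_0+u_1x_i+\cdots+u_{n-1}x_i^{n-1}$ ($i=1,\ldots,n$). *)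

theory Defs
  imports
    "HOL-Algebra.Algebraic_Closure_Type"
    "HOL-Algebra.Generated_Fields"
    "HOL-Library.Poly_Mapping"
    "HOL-Library.FuncSet"
begin

text \<open>
  \<open>(nat \<Rightarrow>\<^sub>0 nat) \<Rightarrow>\<^sub>0 'k\<close> is the polynomial ring over \<open>'k\<close> in variables indexed by \<open>nat\<close>
  (finitely supported functions from monomials to coefficients), so \<open>'k ratfun\<close> is a field of
  rational functions in countably many independent variables. It serves as an ambient field: for
  given \<open>n\<close>, only the subfield \<open>kxy n\<close> generated by \<open>2 n\<close> of the variables is used.
\<close>

type_synonym 'k ratfun = "((nat \<Rightarrow>\<^sub>0 nat) \<Rightarrow>\<^sub>0 'k) fract"

definition rconst :: "'k::field \<Rightarrow> 'k ratfun" where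
  "rconst c = to_fract (Poly_Mapping.single 0 c)"

definition rvar :: "nat \<Rightarrow> 'k::field ratfun" where
  "rvar v = to_fract (Poly_Mapping.single (Poly_Mapping.single v 1) 1)"

text \<open>The variables \<open>x\<^sub>i\<close> and \<open>y\<^sub>i\<close> (used for \<open>1 \<le> i \<le> n\<close>) are pairwise different variables:
  those with even and odd numbers, respectively.\<close>

definition xvar :: "nat \<Rightarrow> 'k::field ratfun" where
  "xvar i = rvar (2 * i)"

definition yvar :: "nat \<Rightarrow> 'k::field ratfun" where
  "yvar i = rvar (2 * i + 1)"

definition elem_sym :: "nat \<Rightarrow> nat \<Rightarrow> (nat \<Rightarrow> 'a::comm_ring_1) \<Rightarrow> 'a" where
  "elem_sym n j z = (\<Sum>A | A \<subseteq> {1..n} \<and> card A = j. \<Prod>i\<in>A. z i)"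

definition adjoin :: "'a::field set \<Rightarrow> 'a set \<Rightarrow> 'a set" where
  "adjoin F S = generate_field ring_of_type_algebra (F \<union> S)"

definition kxy :: "nat \<Rightarrow> 'k::field ratfun set" where
  "kxy n = adjoin (range rconst) (xvar ` {1..n} \<union> yvar ` {1..n})"

definition K_st :: "nat \<Rightarrow> 'k::field ratfun set" where
  "K_st n = adjoin (range rconst)
     ((\<lambda>j. elem_sym n j xvar) ` {1..n} \<union> (\<lambda>j. elem_sym n j yvar) ` {1..n})"

definition L_s :: "nat \<Rightarrow> 'k::field ratfun set" where
  "L_s n = adjoin (K_st n) (xvar ` {1..n})"

definition L_t :: "nat \<Rightarrow> 'k::field ratfun set" where
  "L_t n = adjoin (K_st n) (yvar ` {1..n})"

text \<open>The automorphisms of the field \<open>E\<close> fixing \<open>F\<close> pointwise, for subfields \<open>F \<subseteq> E\<close> of the type.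
  Being extensional makes an automorphism of \<open>E\<close> determined by its values on \<open>E\<close>.\<close>

definition Gal :: "'a::field set \<Rightarrow> 'a set \<Rightarrow> ('a \<Rightarrow> 'a) set" where
  "Gal E F = {g \<in> ring_iso (ring_of_type_algebra\<lparr>carrier := E\<rparr>) (ring_of_type_algebra\<lparr>carrier := E\<rparr>)
                \<inter> extensional E. \<forall>a\<in>F. g a = a}"

definition G_st :: "nat \<Rightarrow> ('k::field ratfun \<Rightarrow> 'k ratfun) set" where
  "G_st n = Gal (kxy n) (K_st n)"

text \<open>A solution is a family indexed by \<open>{..<n}\<close>; as a total function it is padded with \<open>0\<close>.\<close>

definition is_solution :: "nat \<Rightarrow> (nat \<Rightarrow> 'k::field ratfun) \<Rightarrow> bool" where
  "is_solution n w \<longleftrightarrow>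
     (\<forall>j<n. w j \<in> kxy n) \<and> (\<forall>j\<ge>n. w j = 0) \<and>
     (\<forall>i\<in>{1..n}. yvar i = (\<Sum>j<n. w j * xvar i ^ j))"

definition u_st :: "nat \<Rightarrow> nat \<Rightarrow> 'k::field ratfun" where
  "u_st n = (THE w. is_solution n w)"


text \<open>Existence and uniqueness of the solution, so that \<open>u_st\<close> is well defined:\<close>

lemma rta_sel [simp]:
  "carrier (ring_of_type_algebra :: 'a::field ring) = UNIV"
  "\<zero>\<^bsub>(ring_of_type_algebra :: 'a::field ring)\<^esub> = 0"
  "\<one>\<^bsub>(ring_of_type_algebra :: 'a::field ring)\<^esub> = 1"
  "a \<oplus>\<^bsub>(ring_of_type_algebra :: 'a::field ring)\<^esub> b = a + b"
  "a \<otimes>\<^bsub>(ring_of_type_algebra :: 'a::field ring)\<^esub> b = a * b"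
  by (simp_all add: ring_of_type_algebra_def)

lemma rta_a_inv [simp]: "\<ominus>\<^bsub>(ring_of_type_algebra :: 'a::field ring)\<^esub> a = - a"
proof -
  interpret R: Ring.field "ring_of_type_algebra :: 'a ring"
    by (rule field_from_type_algebra)
  show ?thesis
    by (rule R.add.inv_equality) auto
qed

lemma rta_m_inv [simp]:
  assumes "(a::'a::field) \<noteq> 0"
  shows "inv\<^bsub>(ring_of_type_algebra :: 'a ring)\<^esub> a = inverse a"
proof -
  interpret R: Ring.field "ring_of_type_algebra :: 'a ring"
    by (rule field_from_type_algebra)
  show ?thesis
    using assms by (intro R.inv_char) auto
qed

lemma adjoin_closed:
  shows adjoin_0: "0 \<in> adjoin F S" and adjoin_1: "1 \<in> adjoin F S"
    and adjoin_base: "a \<in> F \<Longrightarrow> a \<in> adjoin F S"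
    and adjoin_incl: "a \<in> S \<Longrightarrow> a \<in> adjoin F S"
    and adjoin_uminus: "a \<in> adjoin F S \<Longrightarrow> - a \<in> adjoin F S"
    and adjoin_inverse: "a \<in> adjoin F S \<Longrightarrow> inverse a \<in> adjoin F S"
    and adjoin_add: "a \<in> adjoin F S \<Longrightarrow> b \<in> adjoin F S \<Longrightarrow> a + b \<in> adjoin F S"
    and adjoin_mult: "a \<in> adjoin F S \<Longrightarrow> b \<in> adjoin F S \<Longrightarrow> a * b \<in> adjoin F S"
proof -
  interpret R: Ring.field "ring_of_type_algebra :: 'a ring"
    by (rule field_from_type_algebra)
  show 0: "0 \<in> adjoin F S"
    using R.zero_in_generate[of "F \<union> S"] by (simp add: adjoin_def)
  show "1 \<in> adjoin F S"
    using generate_field.one[of "ring_of_type_algebra :: 'a ring"] by (simp add: adjoin_def)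
  show "a \<in> F \<Longrightarrow> a \<in> adjoin F S" "a \<in> S \<Longrightarrow> a \<in> adjoin F S"
    by (auto simp: adjoin_def intro: generate_field.incl)
  show "a \<in> adjoin F S \<Longrightarrow> - a \<in> adjoin F S"
    using generate_field.a_inv[of a "ring_of_type_algebra :: 'a ring"] by (simp add: adjoin_def)
  show "a \<in> adjoin F S \<Longrightarrow> inverse a \<in> adjoin F S"
    using generate_field.m_inv[of a "ring_of_type_algebra :: 'a ring"] 0
    by (cases "a = 0") (simp_all add: adjoin_def)
  show "a \<in> adjoin F S \<Longrightarrow> b \<in> adjoin F S \<Longrightarrow> a + b \<in> adjoin F S"
    using generate_field.eng_add[of a "ring_of_type_algebra :: 'a ring" _ b]
    by (simp add: adjoin_def)
  show "a \<in> adjoin F S \<Longrightarrow> b \<in> adjoin F S \<Longrightarrow> a * b \<in> adjoin F S"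
    using generate_field.eng_mult[of a "ring_of_type_algebra :: 'a ring" _ b]
    by (simp add: adjoin_def)
qed

lemma adjoin_sum: "(\<And>i. i \<in> I \<Longrightarrow> f i \<in> adjoin F S) \<Longrightarrow> (\<Sum>i\<in>I. f i) \<in> adjoin F S"
  by (induction I rule: infinite_finite_induct) (auto intro: adjoin_0 adjoin_add)

lemma adjoin_prod: "(\<And>i. i \<in> I \<Longrightarrow> f i \<in> adjoin F S) \<Longrightarrow> (\<Prod>i\<in>I. f i) \<in> adjoin F S"
  by (induction I rule: infinite_finite_induct) (auto intro: adjoin_1 adjoin_mult)

lemma adjoin_power: "a \<in> adjoin F S \<Longrightarrow> a ^ m \<in> adjoin F S"
  by (induction m) (auto intro: adjoin_1 adjoin_mult)

lemma rvar_eq_iff [simp]: "(rvar v :: 'k::field ratfun) = rvar w \<longleftrightarrow> v = w"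
proof
  assume "(rvar v :: 'k ratfun) = rvar w"
  then have "Poly_Mapping.single (Poly_Mapping.single v 1) (1::'k) =
             Poly_Mapping.single (Poly_Mapping.single w (1::nat)) 1"
    by (simp add: rvar_def)
  then have "Poly_Mapping.keys (Poly_Mapping.single (Poly_Mapping.single v (1::nat)) (1::'k)) =
             Poly_Mapping.keys (Poly_Mapping.single (Poly_Mapping.single w (1::nat)) (1::'k))"
    by simp
  then have "Poly_Mapping.single v (1::nat) = Poly_Mapping.single w 1"
    by simp
  then have "Poly_Mapping.keys (Poly_Mapping.single v (1::nat)) = Poly_Mapping.keys (Poly_Mapping.single w (1::nat))"
    by simp
  then show "v = w"
    by simp
qed simp

lemma interpolation_exists:
  fixes a b :: "nat \<Rightarrow> 'a::field"
  assumes "inj_on a {1..m}"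
    and ab: "\<And>i. i \<in> {1..m} \<Longrightarrow> a i \<in> adjoin F S" "\<And>i. i \<in> {1..m} \<Longrightarrow> b i \<in> adjoin F S"
  shows "\<exists>p. (\<forall>j. coeff p j \<in> adjoin F S) \<and> (\<forall>j\<ge>m. coeff p j = 0) \<and>
             (\<forall>i\<in>{1..m}. poly p (a i) = b i)"
  using assms
proof (induction m)
  case 0
  show ?case
    by (rule exI[of _ 0]) (auto intro: adjoin_0)
next
  case (Suc m)
  have "inj_on a {1..m}"
    using Suc.prems(1) by (rule inj_on_subset) auto
  moreover have "a i \<in> adjoin F S" "b i \<in> adjoin F S" if "i \<in> {1..m}" for i
    using Suc.prems(2,3) that by auto
  ultimately obtain p where p: "\<And>j. coeff p j \<in> adjoin F S" "\<And>j. j \<ge> m \<Longrightarrow> coeff p j = 0"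
      "\<And>i. i \<in> {1..m} \<Longrightarrow> poly p (a i) = b i"
    using Suc.IH by blast
  define q where "q = (\<Prod>i\<in>{1..m}. [:- a i, 1:])"
  have q_coeff: "coeff q j \<in> adjoin F S" for j
  proof -
    have "\<forall>j. coeff (\<Prod>i\<in>I. [:- a i, 1:]) j \<in> adjoin F S" if "finite I" "I \<subseteq> {1..m}" for I
      using that
    proof (induction I rule: finite_induct)
      case empty
      show ?case
        by (auto simp: coeff_pCons one_pCons intro: adjoin_0 adjoin_1 split: nat.split)
    next
      case (insert i I)
      have ai: "a i \<in> adjoin F S"
        using insert.prems Suc.prems(2) by auto
      have lin: "coeff [:- a i, 1:] l \<in> adjoin F S" for l
        using ai
        by (auto simp: coeff_pCons intro: adjoin_0 adjoin_1 adjoin_uminus split: nat.split)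
      show ?case
        using insert.IH insert.prems insert.hyps lin
        unfolding prod.insert[OF insert.hyps] coeff_mult
        by (auto intro!: adjoin_sum adjoin_mult)
    qed
    then show ?thesis
      by (simp add: q_def)
  qed
  have deg_q: "Polynomial.degree q = m"
    unfolding q_def by (subst degree_prod_eq_sum_degree) auto
  have q0: "poly q (a i) = 0" if "i \<in> {1..m}" for i
    using that by (auto simp: q_def poly_prod)
  have q1: "poly q (a (Suc m)) \<noteq> 0"
  proof -
    have "a (Suc m) \<noteq> a i" if "i \<in> {1..m}" for i
      using inj_onD[OF Suc.prems(1), of "Suc m" i] that by auto
    then show ?thesis
      by (auto simp: q_def poly_prod)
  qed
  have poly_mem: "poly r (a (Suc m)) \<in> adjoin F S" if "\<And>j. coeff r j \<in> adjoin F S" for r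
    unfolding poly_altdef using that Suc.prems(2)
    by (auto intro!: adjoin_sum adjoin_mult adjoin_power)
  define c where "c = (b (Suc m) + - poly p (a (Suc m))) * inverse (poly q (a (Suc m)))"
  have c: "c \<in> adjoin F S"
    unfolding c_def
    by (intro adjoin_mult adjoin_inverse adjoin_add adjoin_uminus poly_mem p q_coeff Suc.prems(3))
      simp
  show ?case
  proof (intro exI conjI allI ballI impI)
    fix j
    show "coeff (p + smult c q) j \<in> adjoin F S"
      using p(1) c q_coeff by (auto intro!: adjoin_add adjoin_mult)
  next
    fix j assume "Suc m \<le> j"
    then show "coeff (p + smult c q) j = 0"
      using p(2)[of j] coeff_eq_0[of q j] deg_q by simp
  next
    fix i assume "i \<in> {1..Suc m}"
    then consider "i \<in> {1..m}" | "i = Suc m"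
      by fastforce
    then show "poly (p + smult c q) (a i) = b i"
      using p(3) q0 q1 by cases (auto simp: c_def mult.assoc)
  qed
qed

lemma is_solution_eq:
  "is_solution n w \<Longrightarrow> i \<in> {1..n} \<Longrightarrow> (\<Sum>j<n. w j * xvar i ^ j) = yvar i"
  by (simp add: is_solution_def)

lemma solution_unique: "\<exists>!w. is_solution n (w :: nat \<Rightarrow> 'k::field ratfun)"
proof -
  have inj: "inj_on (xvar :: nat \<Rightarrow> 'k ratfun) A" for A
    by (auto simp: inj_on_def xvar_def)
  have "\<exists>p :: 'k ratfun poly. (\<forall>j. coeff p j \<in> kxy n) \<and> (\<forall>j\<ge>n. coeff p j = 0) \<and>
             (\<forall>i\<in>{1..n}. poly p (xvar i) = yvar i)"
    unfolding kxy_def by (intro interpolation_exists inj adjoin_incl) auto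
  then obtain p :: "'k ratfun poly" where p: "\<And>j. coeff p j \<in> kxy n"
      "\<And>j. j \<ge> n \<Longrightarrow> coeff p j = 0" "\<And>i. i \<in> {1..n} \<Longrightarrow> poly p (xvar i) = yvar i"
    by blast
  have eval: "poly r z = (\<Sum>j<n. coeff r j * z ^ j)"
    if "\<And>j. j \<ge> n \<Longrightarrow> coeff r j = 0" for r :: "'k ratfun poly" and z
  proof -
    have "poly r z = (\<Sum>j\<le>Polynomial.degree r + n. coeff r j * z ^ j)"
      unfolding poly_altdef by (rule sum.mono_neutral_left) (auto simp: coeff_eq_0)
    also have "\<dots> = (\<Sum>j<n. coeff r j * z ^ j)"
      by (rule sum.mono_neutral_right) (auto simp: that)
    finally show ?thesis .
  qed
  have "is_solution n (coeff p)"
    using p eval[of p] by (auto simp: is_solution_def)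
  moreover have "w = w'" if w: "is_solution n w" "is_solution n w'"
    for w w' :: "nat \<Rightarrow> 'k ratfun"
  proof -
    define r where "r = (\<Sum>j<n. monom (w j - w' j) j)"
    have r: "coeff r j = (if j < n then w j - w' j else 0)" for j
      by (simp add: r_def coeff_sum if_distrib sum.delta cong: if_cong)
    have zero: "poly r (xvar i) = 0" if "i \<in> {1..n}" for i
    proof -
      have "poly r (xvar i) = (\<Sum>j<n. w j * xvar i ^ j) - (\<Sum>j<n. w' j * xvar i ^ j)"
        by (subst eval) (auto simp: r algebra_simps sum_subtractf)
      also have "\<dots> = yvar i - yvar i"
        using w[THEN is_solution_eq, OF that] by simp
      finally show ?thesis
        by simp
    qed
    have "r = 0"
    proof (rule ccontr)
      assume nz: "r \<noteq> 0"
      then have "coeff r (Polynomial.degree r) \<noteq> 0"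
        by (simp add: Polynomial.leading_coeff_0_iff)
      then have "Polynomial.degree r < n"
        using r[of "Polynomial.degree r"] by (simp split: if_splits)
      moreover have "n \<le> card {z. poly r z = 0}"
      proof -
        have "card (xvar ` {1..n} :: 'k ratfun set) = n"
          using card_image[OF inj] by simp
        then show ?thesis
          using card_mono[OF poly_roots_finite[OF nz], of "xvar ` {1..n}"] zero
          by (simp add: image_subset_iff)
      qed
      ultimately show False
        using card_poly_roots_bound[OF nz] by linarith
    qed
    show ?thesis
    proof
      fix j
      show "w j = w' j"
        using r[of j] w \<open>r = 0\<close> by (cases "j < n") (simp_all add: is_solution_def)
    qed
  qed
  ultimately show ?thesis
    by blast
qed

lemma is_solution_u_st: "is_solution n (u_st n)"
  unfolding u_st_def by (rule theI'[OF solution_unique])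

end

(*
  The group G = S_n x S_n acts by renaming variables.  By Lagrange interpolation an image
  v = g(u_i) has the form sum_i y_i c(rho(i)) with rho a permutation and c(1), ..., c(n) in k(x).
  The c(i) are pairwise different (this needs n >= 3) and the y_i are linearly independent over
  k(x), so (sigma, tau) fixes v exactly if sigma rho = rho tau.  This stabilizer meets S_n x 1 and
  1 x S_n trivially, which gives (ii), and together with either of these factors it generates
  all of G, which gives (i).
*)
theory Submission
  imports Defs "HOL-Combinatorics.Permutations"
begin

section \<open>Subfields and endomorphisms\<close>

text \<open>An element of \<open>G_st n\<close> enters only through two permutations \<sigma>,
  \<tau>: it maps roots of the two root polynomials to roots. Applied to the defining system it
  gives y_i = sum_j v_j x_{\<rho>(i)}^j with \<rho> = \<sigma> \<tau>^-1, so c(i) is the degree-j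
  coefficient of the Lagrange basis polynomial at the node x_i. From there on the group acts through
  total endomorphisms \<open>act\<close> of the ambient field. These may move variables outside
  \<open>kxy n\<close>, and exchanging a variable with a fresh one replaces degree arguments in the
  variables. The Galois theory is reduced to two statements: invariant elements descend
  (\<open>fixed_symmetric\<close>), and an element with pairwise distinct conjugates generates
  (\<open>primitive_element\<close>). Both conclude by comparing a polynomial's values at enough
  points. The bound on n matters: for n = 2 in characteristic 2 one has c(1) = c(2) = 1/(x_1 + x_2)
  at j = 1, and u_1 = (y_1 + y_2)/(x_1 + x_2) already lies in K.\<close>

locale subfield_set =
  fixes F :: "'a::field set"
  assumes zero: "0 \<in> F" and one: "1 \<in> F"
    and add: "a \<in> F \<Longrightarrow> b \<in> F \<Longrightarrow> a + b \<in> F"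
    and mult: "a \<in> F \<Longrightarrow> b \<in> F \<Longrightarrow> a * b \<in> F"
    and uminus: "a \<in> F \<Longrightarrow> - a \<in> F"
    and inverse: "a \<in> F \<Longrightarrow> inverse a \<in> F"
begin

lemma diff: "a \<in> F \<Longrightarrow> b \<in> F \<Longrightarrow> a - b \<in> F"
  using add[of a "- b"] uminus[of b] by simp

lemma divide: "a \<in> F \<Longrightarrow> b \<in> F \<Longrightarrow> a / b \<in> F"
  by (simp add: divide_inverse inverse mult)

lemma sum: "(\<And>i. i \<in> I \<Longrightarrow> f i \<in> F) \<Longrightarrow> sum f I \<in> F"
  by (induction I rule: infinite_finite_induct) (auto intro: zero add)

lemma prod: "(\<And>i. i \<in> I \<Longrightarrow> f i \<in> F) \<Longrightarrow> prod f I \<in> F"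
  by (induction I rule: infinite_finite_induct) (auto intro: one mult)

lemma power: "a \<in> F \<Longrightarrow> a ^ m \<in> F"
  by (induction m) (auto intro: one mult)

end

lemma subfield_set_adjoin: "subfield_set (adjoin F S)"
  by unfold_locales
    (auto intro: adjoin_0 adjoin_1 adjoin_add adjoin_mult adjoin_uminus adjoin_inverse)

text \<open>Serves as the induction principle for \<open>adjoin\<close>: a property of all its
  elements is proved by checking that the elements having it form a subfield that contains the
  generators.\<close>

lemma adjoin_least:
  assumes "subfield_set T" and "F \<subseteq> T" and "S \<subseteq> T"
  shows "adjoin F S \<subseteq> T"
proof
  interpret subfield_set T by fact
  fix a assume "a \<in> adjoin F S"
  then show "a \<in> T"
    unfolding adjoin_def
  proof (induction rule: generate_field.induct)
    case (m_inv h)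
    then show ?case by (simp add: inverse)
  qed (use assms in \<open>auto intro: one uminus add mult\<close>)
qed

lemma adjoin_mono: "F \<subseteq> F' \<Longrightarrow> S \<subseteq> S' \<Longrightarrow> adjoin F S \<subseteq> adjoin F' S'"
  by (intro adjoin_least subfield_set_adjoin) (auto intro: adjoin_base adjoin_incl)

text \<open>Total on the type, so \<open>map_poly\<close> applies without carrier conditions.
  Injectivity is automatic (\<open>hom_inj\<close>), and on a finite set mapped into itself it
  already gives a bijection.\<close>

locale field_endo =
  fixes h :: "'a::field \<Rightarrow> 'a"
  assumes hom_add: "h (a + b) = h a + h b"
    and hom_mult: "h (a * b) = h a * h b"
    and hom_one: "h 1 = 1"
begin

lemma hom_zero: "h 0 = 0"
  using hom_add[of 0 0] by (metis add.right_neutral add_left_cancel)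

lemma hom_uminus: "h (- a) = - h a"
  using hom_add[of a "- a"] by (simp add: hom_zero eq_neg_iff_add_eq_0 add.commute)

lemma hom_diff: "h (a - b) = h a - h b"
  using hom_add[of a "- b"] by (simp add: hom_uminus)

lemma hom_eq_0_iff: "h a = 0 \<longleftrightarrow> a = 0"
proof
  assume "h a = 0"
  then show "a = 0"
    using hom_mult[of a "inverse a"] by (cases "a = 0") (simp_all add: hom_one)
qed (simp add: hom_zero)

lemma hom_inj: "h a = h b \<longleftrightarrow> a = b"
  using hom_eq_0_iff[of "a - b"] by (simp add: hom_diff)

lemma hom_inverse: "h (inverse a) = inverse (h a)"
proof (cases "a = 0")
  case False
  then have "h a * h (inverse a) = 1"
    using hom_mult[of a "inverse a"] by (simp add: hom_one)
  then show ?thesis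
    by (simp add: inverse_unique)
qed (simp add: hom_zero)

lemma hom_divide: "h (a / b) = h a / h b"
  by (simp add: divide_inverse hom_mult hom_inverse)

lemma hom_sum: "h (sum f I) = (\<Sum>i\<in>I. h (f i))"
  by (induction I rule: infinite_finite_induct) (auto simp: hom_zero hom_add)

lemma hom_power: "h (a ^ m) = h a ^ m"
  by (induction m) (auto simp: hom_one hom_mult)

lemma coeff_map: "coeff (map_poly h p) j = h (coeff p j)"
  by (simp add: coeff_map_poly hom_zero)

lemma map_poly_mult: "map_poly h (p * q) = map_poly h p * map_poly h q"
  by (rule poly_eqI) (simp add: coeff_map coeff_mult hom_sum hom_mult)

lemma map_poly_1: "map_poly h 1 = 1"
  by (rule poly_eqI) (simp add: coeff_map hom_one hom_zero)

lemma map_poly_linear: "map_poly h [:a, b:] = [:h a, h b:]"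
  by (rule poly_eqI) (simp add: coeff_map coeff_pCons hom_zero split: nat.split)

lemma map_poly_prod: "map_poly h (prod f I) = (\<Prod>i\<in>I. map_poly h (f i))"
  by (induction I rule: infinite_finite_induct) (auto simp: map_poly_1 map_poly_mult)

lemma poly_map_poly: "poly (map_poly h p) (h z) = h (poly p z)"
proof -
  have "Polynomial.degree (map_poly h p) = Polynomial.degree p"
    by (intro degree_map_poly) (simp add: hom_eq_0_iff)
  then show ?thesis
    by (simp add: poly_altdef coeff_map hom_sum hom_mult hom_power)
qed

lemma subfield_set_fixed: "subfield_set {a. h a = a}"
  by unfold_locales
    (auto simp: hom_zero hom_one hom_add hom_mult hom_uminus hom_inverse)

lemma fixes_adjoin:
  assumes "\<And>a. a \<in> F \<Longrightarrow> h a = a" "\<And>a. a \<in> S \<Longrightarrow> h a = a" "a \<in> adjoin F S"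
  shows "h a = a"
  using adjoin_least[OF subfield_set_fixed, of F S] assms by auto

lemma subfield_set_vimage:
  assumes "subfield_set F" shows "subfield_set (h -` F)"
proof -
  interpret subfield_set F by fact
  show ?thesis
    by unfold_locales
      (auto simp: hom_zero hom_one hom_add hom_mult hom_uminus hom_inverse
        intro: zero one add mult uminus inverse)
qed

end

section \<open>Polynomials with coefficients in a subfield, and simple extensions\<close>

definition polys_over :: "'a::field set \<Rightarrow> 'a poly set" where
  "polys_over F = {p. \<forall>j. coeff p j \<in> F}"

lemma polys_overD: "p \<in> polys_over F \<Longrightarrow> coeff p j \<in> F"
  by (simp add: polys_over_def)

lemma polys_over_mono: "F \<subseteq> F' \<Longrightarrow> polys_over F \<subseteq> polys_over F'"
  by (auto simp: polys_over_def)

text \<open>Degree bounds are mostly stated as vanishing of all coefficients from \<open>d\<close>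
  on. This treats the zero polynomial correctly even for \<open>d = 0\<close>, where
  \<open>degree 0 = 0\<close> would get in the way.\<close>

lemma degree_less_if_coeffs_0:
  "p \<noteq> 0 \<Longrightarrow> \<forall>j\<ge>d. coeff p j = 0 \<Longrightarrow> Polynomial.degree p < d"
  by (metis Polynomial.leading_coeff_0_iff not_le)

context subfield_set begin

lemma polys_over_const: "a \<in> F \<Longrightarrow> [:a:] \<in> polys_over F"
  by (auto simp: polys_over_def coeff_pCons zero split: nat.split)

lemma polys_over_linear: "a \<in> F \<Longrightarrow> b \<in> F \<Longrightarrow> [:a, b:] \<in> polys_over F"
  by (auto simp: polys_over_def coeff_pCons zero split: nat.split)

lemma polys_over_0: "0 \<in> polys_over F"
  by (simp add: polys_over_def zero)

lemma polys_over_monom: "a \<in> F \<Longrightarrow> monom a m \<in> polys_over F"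
  by (simp add: polys_over_def zero)

lemma polys_over_add: "p \<in> polys_over F \<Longrightarrow> q \<in> polys_over F \<Longrightarrow> p + q \<in> polys_over F"
  by (simp add: polys_over_def add)

lemma polys_over_diff: "p \<in> polys_over F \<Longrightarrow> q \<in> polys_over F \<Longrightarrow> p - q \<in> polys_over F"
  by (simp add: polys_over_def diff)

lemma polys_over_uminus: "p \<in> polys_over F \<Longrightarrow> - p \<in> polys_over F"
  by (simp add: polys_over_def uminus)

lemma polys_over_sum: "(\<And>i. i \<in> I \<Longrightarrow> f i \<in> polys_over F) \<Longrightarrow> sum f I \<in> polys_over F"
  by (induction I rule: infinite_finite_induct) (auto intro: polys_over_0 polys_over_add)

lemma polys_over_mult: "p \<in> polys_over F \<Longrightarrow> q \<in> polys_over F \<Longrightarrow> p * q \<in> polys_over F"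
  by (simp add: polys_over_def coeff_mult sum mult)

lemma poly_in: "p \<in> polys_over F \<Longrightarrow> z \<in> F \<Longrightarrow> poly p z \<in> F"
  unfolding poly_altdef by (intro sum mult power polys_overD)

text \<open>Long division; the point is that quotient and remainder keep their coefficients in the
  set \<open>F\<close>, which the type does not record. The induction is on a bound \<open>N\<close>
  for the nonzero coefficients of \<open>f\<close>.\<close>

lemma polys_over_division:
  assumes g: "g \<in> polys_over F" "g \<noteq> 0" and f: "f \<in> polys_over F"
  shows "\<exists>q\<in>polys_over F. \<exists>r\<in>polys_over F. f = q * g + r \<and> (\<forall>j\<ge>Polynomial.degree g. coeff r j = 0)"
proof -
  have "\<exists>q\<in>polys_over F. \<exists>r\<in>polys_over F. f = q * g + r \<and> (\<forall>j\<ge>Polynomial.degree g. coeff r j = 0)"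
    if "f \<in> polys_over F" "\<forall>j\<ge>N. coeff f j = 0" for f N
    using that
  proof (induction N arbitrary: f)
    case 0
    then have "f = 0"
      by (intro poly_eqI) simp
    then show ?case
      by (auto intro!: bexI[of _ 0] polys_over_0)
  next
    case (Suc N)
    show ?case
    proof (cases "N < Polynomial.degree g")
      case True
      then show ?thesis
        using Suc.prems by (intro bexI[of _ 0] bexI[of _ f]) (auto intro: polys_over_0)
    next
      case False
      \<comment> \<open>The term that cancels the coefficient of \<open>f\<close> at
        \<open>N\<close>, lowering the bound by one.\<close>
      define m where "m = monom (coeff f N / lead_coeff g) (N - Polynomial.degree g)"
      have m: "m \<in> polys_over F"
        unfolding m_def using Suc.prems(1) g(1) by (intro polys_over_monom divide polys_overD)
      have "coeff (f - m * g) j = 0" if "j \<ge> N" for j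
      proof (cases "j = N")
        case True
        then show ?thesis
          using False g(2) by (simp add: m_def coeff_monom_mult)
      next
        case j: False
        then have "coeff g (j - (N - Polynomial.degree g)) = 0"
          using that False by (intro coeff_eq_0) linarith
        then show ?thesis
          using that j Suc.prems(2) by (simp add: m_def coeff_monom_mult)
      qed
      moreover have "f - m * g \<in> polys_over F"
        using Suc.prems(1) m g(1) by (intro polys_over_diff polys_over_mult)
      ultimately obtain q r where "q \<in> polys_over F" "r \<in> polys_over F" "f - m * g = q * g + r"
          "\<forall>j\<ge>Polynomial.degree g. coeff r j = 0"
        using Suc.IH[of "f - m * g"] by blast
      then show ?thesis
        by (intro bexI[of _ "q + m"] bexI[of _ r])
          (auto simp: algebra_simps intro: polys_over_add m)
    qed
  qed
  from this[OF f, of "Suc (Polynomial.degree f)"] show ?thesis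
    by (simp add: coeff_eq_0)
qed

text \<open>Euclid's algorithm with \<open>M\<close> of least degree: \<open>M = s * p + r\<close>
  reads \<open>poly r z = - (poly s z * poly p z)\<close> at \<open>z\<close>, so an inverse of
  \<open>poly r z\<close>, available by induction, yields one of \<open>poly p z\<close>. If
  \<open>r\<close> were 0, then \<open>s\<close> would vanish at \<open>z\<close> with degree below
  that of \<open>M\<close>.\<close>

lemma polys_over_inverse:
  assumes M: "M \<in> polys_over F" "M \<noteq> 0" "poly M z = 0"
    and min: "\<And>q. q \<in> polys_over F \<Longrightarrow> q \<noteq> 0 \<Longrightarrow> Polynomial.degree q < Polynomial.degree M \<Longrightarrow> poly q z \<noteq> 0"
  shows "p \<in> polys_over F \<Longrightarrow> p \<noteq> 0 \<Longrightarrow> Polynomial.degree p < Polynomial.degree M \<Longrightarrow>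
    \<exists>q\<in>polys_over F. poly p z * poly q z = 1"
proof (induction "Polynomial.degree p" arbitrary: p rule: less_induct)
  case less
  note pz = min[OF less.prems]
  obtain s r where sr: "s \<in> polys_over F" "r \<in> polys_over F" "M = s * p + r"
      "\<forall>j\<ge>Polynomial.degree p. coeff r j = 0"
    using polys_over_division[OF less.prems(1,2) M(1)] by blast
  show ?case
  proof (cases "Polynomial.degree p = 0")
    case True
    then obtain c where "p = [:c:]"
      by (rule degree_eq_zeroE)
    moreover from this have "c \<in> F" "c \<noteq> 0"
      using less.prems(1,2) polys_overD[of p F 0] by simp_all
    ultimately show ?thesis
      by (intro bexI[of _ "[:inverse c:]"] polys_over_const inverse) simp_all
  next
    case False
    have "r \<noteq> 0"
    proof
      assume "r = 0"
      then have "M = s * p"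
        using sr(3) by simp
      then have "s \<noteq> 0" "Polynomial.degree s < Polynomial.degree M" "poly s z = 0"
        using M pz False by (auto simp: degree_mult_eq)
      then show False
        using min sr(1) by blast
    qed
    with sr(4) have "Polynomial.degree r < Polynomial.degree p"
      by (intro degree_less_if_coeffs_0)
    then obtain q where q: "q \<in> polys_over F" "poly r z * poly q z = 1"
      using less.hyps[of r] sr(2) \<open>r \<noteq> 0\<close> less.prems(3) by auto
    have "poly s z * poly p z + poly r z = 0"
      using sr(3) M(3) by auto
    then have "poly r z = - (poly s z * poly p z)"
      by (simp add: eq_neg_iff_add_eq_0 add.commute)
    then have "poly p z * poly (- s * q) z = 1"
      using q(2) by (simp add: algebra_simps)
    then show ?thesis
      using sr(1) q(1) by (blast intro: polys_over_uminus polys_over_mult)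
  qed
qed

text \<open>Inverses are found modulo a \<open>Q\<close> of least degree, which makes the polynomial
  values at \<open>z\<close> a field. The coefficient bound is wanted for the given, possibly
  reducible \<open>M\<close>, hence the final reduction modulo \<open>M\<close>.\<close>

lemma simple_extension:
  assumes M: "M \<in> polys_over F" "M \<noteq> 0" "poly M z = 0" and a: "a \<in> adjoin F {z}"
  obtains p where "p \<in> polys_over F" "\<forall>j\<ge>Polynomial.degree M. coeff p j = 0" "a = poly p z"
proof -
  have reduce: "\<exists>r\<in>polys_over F. poly r z = poly p z \<and> (\<forall>j\<ge>Polynomial.degree Q. coeff r j = 0)"
    if "p \<in> polys_over F" "Q \<in> polys_over F" "Q \<noteq> 0" "poly Q z = 0" for p Q
    using polys_over_division[OF that(2,3,1)] that(4) by fastforce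
  obtain Q where Q: "Q \<in> polys_over F" "Q \<noteq> 0" "poly Q z = 0"
    and min: "\<And>q. q \<in> polys_over F \<and> q \<noteq> 0 \<and> poly q z = 0 \<Longrightarrow> Polynomial.degree Q \<le> Polynomial.degree q"
    using ex_has_least_nat[of "\<lambda>q. q \<in> polys_over F \<and> q \<noteq> 0 \<and> poly q z = 0" M Polynomial.degree] M
    by blast
  define T where "T = {poly p z | p. p \<in> polys_over F}"
  have T: "poly p z \<in> T" if "p \<in> polys_over F" for p
    using that by (auto simp: T_def)
  have "subfield_set T"
  proof
    show "0 \<in> T" "1 \<in> T"
      using T[of 0] T[of "[:1:]"] by (auto intro: polys_over_0 polys_over_const one)
  next
    fix b c assume "b \<in> T" "c \<in> T"
    then obtain p q where "p \<in> polys_over F" "b = poly p z" "q \<in> polys_over F" "c = poly q z"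
      by (auto simp: T_def)
    then show "b + c \<in> T" "b * c \<in> T"
      using T[of "p + q"] T[of "p * q"] by (auto intro: polys_over_add polys_over_mult)
  next
    fix b assume "b \<in> T"
    then obtain p where p: "p \<in> polys_over F" "b = poly p z"
      by (auto simp: T_def)
    then show "- b \<in> T"
      using T[of "- p"] by (auto intro: polys_over_uminus)
    show "inverse b \<in> T"
    proof (cases "b = 0")
      case True
      then show ?thesis
        using \<open>b \<in> T\<close> by simp
    next
      case False
      obtain r where r: "r \<in> polys_over F" "poly r z = b"
          "\<forall>j\<ge>Polynomial.degree Q. coeff r j = 0"
        using reduce[OF p(1) Q] p(2) by auto
      then have "r \<noteq> 0"
        using False by auto
      have "\<exists>q\<in>polys_over F. poly r z * poly q z = 1"
        using min by (intro polys_over_inverse[OF Q] r(1) \<open>r \<noteq> 0\<close> degree_less_if_coeffs_0 r(3)) force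
      then obtain q where "q \<in> polys_over F" "b * poly q z = 1"
        using r(2) by auto
      then show ?thesis
        using T[of q] inverse_unique[of b "poly q z"] by simp
    qed
  qed
  moreover have "F \<subseteq> T"
  proof
    fix b assume "b \<in> F"
    then show "b \<in> T"
      using T[of "[:b:]"] by (auto intro: polys_over_const)
  qed
  moreover have "{z} \<subseteq> T"
    using T[of "[:0, 1:]"] by (auto intro: polys_over_linear zero one)
  ultimately have "a \<in> T"
    using adjoin_least a by blast
  then obtain p where p: "p \<in> polys_over F" "a = poly p z"
    by (auto simp: T_def)
  obtain r where "r \<in> polys_over F" "poly r z = a" "\<forall>j\<ge>Polynomial.degree M. coeff r j = 0"
    using reduce[OF p(1) M] p(2) by auto
  then show thesis
    using that[of r] by auto
qed

text \<open>Division inside \<open>F\<close> leaves a constant remainder, which evaluation at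
  \<open>z\<close> shows to be 0; cancelling the linear factor identifies \<open>q\<close> with the
  quotient found over \<open>F\<close>. It is what allows a root to be split off after adjoining
  it.\<close>

lemma polys_over_linear_factor:
  assumes "[:- z, 1:] * q \<in> polys_over F" "z \<in> F"
  shows "q \<in> polys_over F"
proof -
  have "[:- z, 1:] \<in> polys_over F" "[:- z, 1:] \<noteq> 0"
    using assms(2) by (simp_all add: polys_over_linear uminus one)
  from polys_over_division[OF this assms(1)]
  obtain s r where sr: "s \<in> polys_over F" "[:- z, 1:] * q = s * [:- z, 1:] + r"
      "\<forall>j\<ge>Polynomial.degree [:- z, 1:]. coeff r j = 0"
    by blast
  have "\<exists>c. r = [:c:]"
    by (rule exI[of _ "coeff r 0"], rule poly_eqI)
      (use sr(3) in \<open>simp add: coeff_pCons split: nat.split\<close>)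
  then obtain c where c: "r = [:c:]" ..
  have "poly ([:- z, 1:] * q) z = poly (s * [:- z, 1:] + r) z"
    using sr(2) by simp
  then have "r = 0"
    using c by simp
  then have "[:- z, 1:] * q = [:- z, 1:] * s"
    using sr(2) by (simp add: mult.commute)
  then have "q = s"
    by (subst (asm) mult_left_cancel) auto
  then show ?thesis
    using sr(1) by simp
qed

end

text \<open>Peel off one root at a time: an element of \<open>F(z\<^sub>b)\<close> is a polynomial in \<open>z\<^sub>b\<close> of degree less
  than \<open>card B\<close>, and invariance under the transpositions makes it take the same value at all
  \<open>card B\<close> roots, so it is constant.\<close>

lemma fixed_symmetric:
  assumes "finite B" "subfield_set F" "inj_on z B" "(\<Prod>b\<in>B. [:- z b, 1:]) \<in> polys_over F"
    and "\<And>i j. i \<in> B \<Longrightarrow> j \<in> B \<Longrightarrow> \<exists>h. field_endo h \<and> (\<forall>x\<in>F. h x = x) \<and> h a = a \<and>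
           (\<forall>l\<in>B. h (z l) = z (transpose i j l))"
    and "a \<in> adjoin F (z ` B)"
  shows "a \<in> F"
  using assms
proof (induction B arbitrary: F rule: finite_induct)
  case empty
  then show ?case
    using adjoin_least[of F F "{}"] by auto
next
  case (insert b B)
  interpret F: subfield_set F by fact
  define E where "E = adjoin F {z b}"
  interpret E: subfield_set E
    unfolding E_def by (rule subfield_set_adjoin)
  have FE: "F \<subseteq> E" and zE: "z b \<in> E"
    by (auto simp: E_def intro: adjoin_base adjoin_incl)
  have "a \<in> E"
  proof (rule insert.IH)
    show "(\<Prod>b\<in>B. [:- z b, 1:]) \<in> polys_over E"
    proof (rule E.polys_over_linear_factor[OF _ zE])
      show "[:- z b, 1:] * (\<Prod>b\<in>B. [:- z b, 1:]) \<in> polys_over E"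
        using insert.prems(3) polys_over_mono[OF FE] unfolding prod.insert[OF insert.hyps] by blast
    qed
  next
    fix i j assume "i \<in> B" "j \<in> B"
    then obtain h where h: "field_endo h" "\<forall>x\<in>F. h x = x" "h a = a"
        "\<forall>l\<in>insert b B. h (z l) = z (transpose i j l)"
      using insert.prems(4)[of i j] by blast
    have "h (z b) = z b"
      using h(4) \<open>i \<in> B\<close> \<open>j \<in> B\<close> insert.hyps by (auto simp: transpose_def)
    then have "\<forall>x\<in>E. h x = x"
      unfolding E_def using h(1,2) by (auto intro: field_endo.fixes_adjoin)
    then show "\<exists>h. field_endo h \<and> (\<forall>x\<in>E. h x = x) \<and> h a = a \<and>
        (\<forall>l\<in>B. h (z l) = z (transpose i j l))"
      using h by blast
  next
    have "adjoin F (z ` insert b B) \<subseteq> adjoin E (z ` B)"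
      using FE zE by (intro adjoin_least subfield_set_adjoin) (auto intro: adjoin_base adjoin_incl)
    then show "a \<in> adjoin E (z ` B)"
      using insert.prems(5) by blast
  qed (use insert.prems in \<open>auto intro: E.subfield_set_axioms\<close>)
  let ?P = "\<Prod>b\<in>insert b B. [:- z b, 1:]"
  have "Polynomial.degree ?P = card (insert b B)"
    using insert.hyps(1) by (subst degree_prod_eq_sum_degree) auto
  moreover have "poly ?P (z b) = 0"
    using insert.hyps by (simp add: poly_prod)
  moreover have "?P \<noteq> 0"
    using insert.hyps(1) by (subst prod_zero_iff) auto
  ultimately obtain p where p: "p \<in> polys_over F" "\<forall>j\<ge>card (insert b B). coeff p j = 0"
      "a = poly p (z b)"
    using F.simple_extension[OF insert.prems(3)] \<open>a \<in> E\<close> by (metis E_def)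
  have root: "poly p (z l) = a" if l: "l \<in> insert b B" for l
  proof -
    obtain h where h: "field_endo h" "\<forall>x\<in>F. h x = x" "h a = a"
        "\<forall>l'\<in>insert b B. h (z l') = z (transpose b l l')"
      using insert.prems(4)[of b l] l by blast
    interpret field_endo h by fact
    have "map_poly h p = p"
      using p(1) h(2) by (intro poly_eqI) (simp add: coeff_map polys_over_def)
    then show ?thesis
      using poly_map_poly[of p "z b"] h(3,4) p(3) by simp
  qed
  have "p = [:a:]"
  proof (rule poly_eqI_degree[of "z ` insert b B"])
    have card: "card (z ` insert b B) = card (insert b B)"
      by (rule card_image) fact
    show "Polynomial.degree [:a:] < card (z ` insert b B)"
      unfolding card using insert.hyps by simp
    show "Polynomial.degree p < card (z ` insert b B)"
      unfolding card using p(2) insert.hyps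
      by (cases "p = 0") (auto intro: degree_less_if_coeffs_0)
  qed (use root in auto)
  then show ?case
    using polys_overD[OF p(1), of 0] by simp
qed

section \<open>Renaming the variables\<close>

text \<open>Injectivity of \<phi> keeps denominators nonzero, so applying \<phi> to numerator and
  denominator does not depend on the chosen fraction.\<close>

lemma fract_endo_exists:
  fixes \<phi> :: "'a::idom \<Rightarrow> 'a"
  assumes add: "\<And>a b. \<phi> (a + b) = \<phi> a + \<phi> b" and mult: "\<And>a b. \<phi> (a * b) = \<phi> a * \<phi> b"
    and one: "\<phi> 1 = 1" and ker: "\<And>a. \<phi> a = 0 \<Longrightarrow> a = 0"
  shows "\<exists>h. field_endo h \<and> (\<forall>a. h (to_fract a) = to_fract (\<phi> a))"
proof -
  define h where "h x = (SOME y. \<exists>a b. b \<noteq> 0 \<and> x = Fract a b \<and> y = Fract (\<phi> a) (\<phi> b))" for x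
  have h: "h (Fract a b) = Fract (\<phi> a) (\<phi> b)" if "b \<noteq> 0" for a b
    unfolding h_def
  proof (rule some_equality)
    show "\<exists>c d. d \<noteq> 0 \<and> Fract a b = Fract c d \<and> Fract (\<phi> a) (\<phi> b) = Fract (\<phi> c) (\<phi> d)"
      using that by blast
  next
    fix y assume "\<exists>c d. d \<noteq> 0 \<and> Fract a b = Fract c d \<and> y = Fract (\<phi> c) (\<phi> d)"
    then obtain c d where cd: "d \<noteq> 0" "Fract a b = Fract c d" "y = Fract (\<phi> c) (\<phi> d)"
      by blast
    then have "a * d = c * b"
      using that by (simp add: eq_fract)
    then have "\<phi> a * \<phi> d = \<phi> c * \<phi> b"
      by (metis mult)
    moreover have "\<phi> b \<noteq> 0" "\<phi> d \<noteq> 0"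
      using ker that cd(1) by blast+
    ultimately show "y = Fract (\<phi> a) (\<phi> b)"
      by (simp add: cd(3) eq_fract)
  qed
  have nz: "\<phi> a \<noteq> 0" if "a \<noteq> 0" for a
    using that ker by blast
  have "field_endo h"
  proof
    fix x y :: "'a fract"
    obtain a b c d where "x = Fract a b" "b \<noteq> 0" "y = Fract c d" "d \<noteq> 0"
      by (metis Fract_cases)
    then show "h (x + y) = h x + h y" "h (x * y) = h x * h y"
      by (simp_all add: h add mult nz)
  qed (simp add: One_fract_def h one)
  moreover have "h (to_fract a) = to_fract (\<phi> a)" for a
    by (simp add: to_fract_def h one)
  ultimately show ?thesis
    by blast
qed

text \<open>\<open>map_key\<close> pulls back along its argument. It is used twice, on monomials and
  then on polynomials, so the two reversals cancel and the variable \<open>v\<close> goes to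
  \<open>\<pi> v\<close>. Multiplicativity is reindexing of the convolution sums by the bijection
  \<tau> of monomials.\<close>

lemma rename_endo_exists:
  assumes "bij \<pi>"
  shows "\<exists>h. field_endo h \<and> (\<forall>c. h (rconst c) = rconst c) \<and>
    (\<forall>v. h (rvar v :: 'k::field ratfun) = rvar (\<pi> v))"
proof -
  define \<tau> :: "(nat \<Rightarrow>\<^sub>0 nat) \<Rightarrow> (nat \<Rightarrow>\<^sub>0 nat)" where "\<tau> = Poly_Mapping.map_key \<pi>"
  have inj: "inj \<pi>" "inj (inv_into UNIV \<pi>)"
    using assms by (auto simp: bij_is_inj bij_imp_bij_inv)
  have \<tau>_inv: "\<tau> (Poly_Mapping.map_key (inv_into UNIV \<pi>) m) = m" "Poly_Mapping.map_key (inv_into UNIV \<pi>) (\<tau> m) = m" for m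
    using inj assms
    by (simp_all add: \<tau>_def map_key_compose bij_is_surj map_key_id surj_iff[symmetric] o_def id_def surj_f_inv_f)
  then have bij: "bij \<tau>"
    by (intro bijI inj_on_inverseI[where g = "Poly_Mapping.map_key (inv_into UNIV \<pi>)"] surjI) auto
  then have inj\<tau>: "inj \<tau>"
    by (rule bij_is_inj)
  have \<tau>_add: "\<tau> (m + m') = \<tau> m + \<tau> m'" for m m'
    unfolding \<tau>_def using inj(1) by (rule map_key_plus)
  have \<tau>_single: "\<tau> (Poly_Mapping.single (\<pi> v) e) = Poly_Mapping.single v e" for v e
    unfolding \<tau>_def using inj(1) by (rule map_key_single)
  have \<tau>_0: "\<tau> 0 = 0"
    unfolding \<tau>_def using inj(1) by (rule map_key_zero)
  define \<phi> :: "((nat \<Rightarrow>\<^sub>0 nat) \<Rightarrow>\<^sub>0 'k) \<Rightarrow> _" where "\<phi> = Poly_Mapping.map_key \<tau>"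
  have lookup: "Poly_Mapping.lookup (\<phi> p) m = Poly_Mapping.lookup p (\<tau> m)" for p m
    unfolding \<phi>_def using inj\<tau> by (simp add: map_key.rep_eq)
  have add: "\<phi> (p + q) = \<phi> p + \<phi> q" for p q
    unfolding \<phi>_def using inj\<tau> by (rule map_key_plus)
  have single: "\<phi> (Poly_Mapping.single (\<tau> m) c) = Poly_Mapping.single m c" for m c
    unfolding \<phi>_def using inj\<tau> by (rule map_key_single)
  have mult: "\<phi> (p * q) = \<phi> p * \<phi> q" for p q
  proof (rule poly_mapping_eqI)
    fix k
    have eq: "\<tau> k = \<tau> l + \<tau> r \<longleftrightarrow> k = l + r" for l r
      using inj\<tau> by (simp add: \<tau>_add[symmetric] inj_eq)
    have "Poly_Mapping.lookup (\<phi> (p * q)) k =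
        Sum_any (\<lambda>l. Poly_Mapping.lookup p l * Sum_any (\<lambda>r. Poly_Mapping.lookup q r when \<tau> k = l + r))"
      by (simp add: lookup times_poly_mapping.rep_eq prod_fun_def)
    also have "\<dots> = Sum_any (\<lambda>l. Poly_Mapping.lookup p (\<tau> l) * Sum_any (\<lambda>r. Poly_Mapping.lookup q (\<tau> r) when k = l + r))"
    proof (rule Sum_any.reindex_cong[OF bij], rule ext, unfold o_def)
      fix l
      have "Sum_any (\<lambda>r. Poly_Mapping.lookup q r when \<tau> k = \<tau> l + r) =
          Sum_any (\<lambda>r. Poly_Mapping.lookup q (\<tau> r) when k = l + r)"
        by (rule Sum_any.reindex_cong[OF bij]) (simp add: o_def eq)
      then show "Poly_Mapping.lookup p (\<tau> l) * Sum_any (\<lambda>r. Poly_Mapping.lookup q r when \<tau> k = \<tau> l + r) =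
          Poly_Mapping.lookup p (\<tau> l) * Sum_any (\<lambda>r. Poly_Mapping.lookup q (\<tau> r) when k = l + r)"
        by simp
    qed
    also have "\<dots> = Poly_Mapping.lookup (\<phi> p * \<phi> q) k"
      by (simp add: lookup times_poly_mapping.rep_eq prod_fun_def)
    finally show "Poly_Mapping.lookup (\<phi> (p * q)) k = Poly_Mapping.lookup (\<phi> p * \<phi> q) k" .
  qed
  have one: "\<phi> 1 = 1"
    using single[of 0 1] by (simp add: \<tau>_0)
  have ker: "p = 0" if "\<phi> p = 0" for p
  proof (rule poly_mapping_eqI)
    fix m
    show "Poly_Mapping.lookup p m = Poly_Mapping.lookup 0 m"
      using lookup[of p "Poly_Mapping.map_key (inv_into UNIV \<pi>) m"] that by (simp add: \<tau>_inv)
  qed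
  obtain h where h: "field_endo h" "\<And>a. h (to_fract a) = to_fract (\<phi> a)"
    using fract_endo_exists[of \<phi>, OF add mult one ker] by blast
  have "h (rconst c) = rconst c" for c
    using single[of 0 c] by (simp add: rconst_def h(2) \<tau>_0)
  moreover have "h (rvar v) = rvar (\<pi> v)" for v
    using single[of "Poly_Mapping.single (\<pi> v) 1" 1] by (simp add: rvar_def h(2) \<tau>_single)
  ultimately show ?thesis
    using h(1) by blast
qed

definition act :: "(nat \<Rightarrow> nat) \<Rightarrow> (nat \<Rightarrow> nat) \<Rightarrow> 'k::field ratfun \<Rightarrow> 'k ratfun" where
  "act \<sigma> \<tau> = (SOME h. field_endo h \<and> (\<forall>c. h (rconst c) = rconst c) \<and>
     (\<forall>i. h (xvar i) = xvar (\<sigma> i)) \<and> (\<forall>i. h (yvar i) = yvar (\<tau> i)))"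

lemma
  assumes "bij \<sigma>" "bij \<tau>"
  shows field_endo_act: "field_endo (act \<sigma> \<tau> :: 'k::field ratfun \<Rightarrow> _)"
    and act_rconst: "act \<sigma> \<tau> (rconst (c::'k)) = rconst c"
    and act_xvar: "act \<sigma> \<tau> (xvar i :: 'k ratfun) = xvar (\<sigma> i)"
    and act_yvar: "act \<sigma> \<tau> (yvar i :: 'k ratfun) = yvar (\<tau> i)"
proof -
  define \<pi> where "\<pi> v = (if even v then 2 * \<sigma> (v div 2) else 2 * \<tau> (v div 2) + 1)" for v
  have "bij \<pi>"
  proof (rule o_bij)
    let ?f = "\<lambda>v. if even v then 2 * inv_into UNIV \<sigma> (v div 2) else 2 * inv_into UNIV \<tau> (v div 2) + 1"
    have "inv_into UNIV \<sigma> (\<sigma> m) = m" "inv_into UNIV \<tau> (\<tau> m) = m" "\<sigma> (inv_into UNIV \<sigma> m) = m" "\<tau> (inv_into UNIV \<tau> m) = m" for m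
      using assms by (simp_all add: bij_is_inj bij_is_surj surj_f_inv_f)
    then show "?f \<circ> \<pi> = id" "\<pi> \<circ> ?f = id"
      by (auto simp: fun_eq_iff \<pi>_def)
  qed
  then obtain h :: "'k ratfun \<Rightarrow> 'k ratfun" where "field_endo h" "\<forall>c. h (rconst c) = rconst c"
      "\<forall>v. h (rvar v) = rvar (\<pi> v)"
    using rename_endo_exists by blast
  then have "field_endo h \<and> (\<forall>c. h (rconst c) = rconst c) \<and>
      (\<forall>i. h (xvar i) = xvar (\<sigma> i)) \<and> (\<forall>i. h (yvar i) = yvar (\<tau> i))"
    by (simp add: xvar_def yvar_def \<pi>_def)
  from someI[of "\<lambda>h. field_endo h \<and> (\<forall>c. h (rconst c) = rconst c) \<and>
      (\<forall>i. h (xvar i) = xvar (\<sigma> i)) \<and> (\<forall>i. h (yvar i) = yvar (\<tau> i))", OF this]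
  show "field_endo (act \<sigma> \<tau> :: 'k ratfun \<Rightarrow> _)" "act \<sigma> \<tau> (rconst (c::'k)) = rconst c"
    "act \<sigma> \<tau> (xvar i :: 'k ratfun) = xvar (\<sigma> i)" "act \<sigma> \<tau> (yvar i :: 'k ratfun) = yvar (\<tau> i)"
    unfolding act_def by blast+
qed

lemma xvar_eq_iff [simp]: "(xvar i :: 'k::field ratfun) = xvar j \<longleftrightarrow> i = j"
  by (simp add: xvar_def)

lemma yvar_eq_iff [simp]: "(yvar i :: 'k::field ratfun) = yvar j \<longleftrightarrow> i = j"
  by (simp add: yvar_def)

text \<open>Vieta's formulas: expand by choosing from each factor either the root (indices in
  \<open>B\<close>) or the indeterminate, and group the choices by \<open>card B\<close>.\<close>

lemma prod_linear_elem_sym: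
  fixes z :: "nat \<Rightarrow> 'a::comm_ring_1"
  shows "(\<Prod>i\<in>{1..n}. [:- z i, 1:]) = (\<Sum>j\<le>n. monom ((-1) ^ j * elem_sym n j z) (n - j))"
proof -
  define c where "c i = [:z i:]" for i
  define q where "q i = [:0, 1 :: 'a:]" for i :: nat
  have summand: "(-1) ^ card B * prod c B * prod q ({1..n} - B)
      = monom ((-1) ^ card B * prod z B) (n - card B)" if "B \<subseteq> {1..n}" for B
  proof -
    have "finite B"
      using that finite_subset by blast
    have "prod c B = [:prod z B:]"
      by (induction B rule: infinite_finite_induct) (auto simp: one_pCons c_def)
    moreover have "(-1) ^ m = [:(-1 :: 'a) ^ m:]" for m
      by (induction m) (auto simp: one_pCons)
    moreover have "prod q ({1..n} - B) = monom 1 (n - card B)"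
      using that \<open>finite B\<close> by (simp add: q_def card_Diff_subset monom_altdef)
    ultimately show ?thesis
      by (simp add: smult_monom)
  qed
  have "(\<Prod>i\<in>{1..n}. [:- z i, 1:]) = (\<Prod>i\<in>{1..n}. q i - c i)"
    by (simp add: q_def c_def)
  also have "\<dots> = (\<Sum>B\<in>Pow {1..n}. (-1) ^ card B * prod c B * prod q ({1..n} - B))"
    by (rule prod_diff_conv_sum) simp
  also have "\<dots> = (\<Sum>B\<in>Pow {1..n}. monom ((-1) ^ card B * prod z B) (n - card B))"
    by (intro sum.cong refl summand) simp
  also have "\<dots> = (\<Sum>j\<le>n. \<Sum>B | B \<in> Pow {1..n} \<and> card B = j.
      monom ((-1) ^ card B * prod z B) (n - card B))"
    by (rule sum.group[symmetric]) (auto dest: card_mono[rotated])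
  also have "\<dots> = (\<Sum>j\<le>n. monom ((-1) ^ j * elem_sym n j z) (n - j))"
  proof (rule sum.cong[OF refl])
    fix j
    show "(\<Sum>B | B \<in> Pow {1..n} \<and> card B = j. monom ((-1) ^ card B * prod z B) (n - card B))
        = monom ((-1) ^ j * elem_sym n j z) (n - j)"
      by (simp add: elem_sym_def sum_distrib_left monom_sum)
  qed
  finally show ?thesis .
qed

lemma (in subfield_set) prod_linear_over:
  assumes "\<And>j. j \<in> {1..n} \<Longrightarrow> elem_sym n j z \<in> F"
  shows "(\<Prod>i\<in>{1..n}. [:- z i, 1:]) \<in> polys_over F"
proof -
  \<comment> \<open>The hypothesis starts at \<open>j = 1\<close>; the remaining function, for
    \<open>j = 0\<close>, gives the leading coefficient 1.\<close>
  have "{A. A \<subseteq> {1..n} \<and> card A = 0} = {{}}"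
    by (auto dest: finite_subset)
  then have "elem_sym n 0 z = 1"
    by (simp add: elem_sym_def)
  then have "elem_sym n j z \<in> F" if "j \<le> n" for j
    using assms[of j] that one by (cases "j = 0") auto
  then show ?thesis
    unfolding prod_linear_elem_sym
    by (intro polys_over_sum polys_over_monom mult power uminus one) auto
qed

text \<open>Read off from the product of the linear factors: \<open>h\<close> merely reorders them,
  so it fixes the coefficients, which are the elementary symmetric functions up to sign.\<close>

lemma (in field_endo) hom_elem_sym:
  assumes "\<sigma> permutes {1..n}" "\<And>i. i \<in> {1..n} \<Longrightarrow> h (z i) = z (\<sigma> i)" "j \<le> n"
  shows "h (elem_sym n j z) = elem_sym n j z"
proof -
  let ?P = "\<Prod>i\<in>{1..n}. [:- z i, 1:]"
  have coeff: "coeff ?P (n - j) = (-1) ^ j * elem_sym n j z"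
  proof -
    have "coeff ?P (n - j) = (\<Sum>i\<le>n. if i = j then (-1) ^ i * elem_sym n i z else 0)"
      unfolding prod_linear_elem_sym coeff_sum coeff_monom
      using assms(3) by (intro sum.cong) auto
    then show ?thesis
      using assms(3) by simp
  qed
  have "map_poly h ?P = (\<Prod>i\<in>{1..n}. [:- z (\<sigma> i), 1:])"
    using assms(2) by (simp add: map_poly_prod map_poly_linear hom_uminus hom_one)
  also have "\<dots> = ?P"
    using prod.permute[OF assms(1), of "\<lambda>i. [:- z i, 1:]"] by (simp add: o_def)
  finally have "h (coeff ?P (n - j)) = coeff ?P (n - j)"
    by (metis coeff_map)
  then have "(-1) ^ j * h (elem_sym n j z) = (-1) ^ j * elem_sym n j z"
    unfolding coeff by (simp add: hom_mult hom_power hom_uminus hom_one)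
  then show ?thesis
    by simp
qed

section \<open>The tower of fields, the action on it and its fixed fields\<close>

lemma subfield_set_tower:
  "subfield_set (K_st n)" "subfield_set (L_s n)" "subfield_set (L_t n)" "subfield_set (kxy n)"
  by (simp_all add: K_st_def L_s_def L_t_def kxy_def subfield_set_adjoin)

lemma K_st_subset: "K_st n \<subseteq> L_s n" "K_st n \<subseteq> L_t n"
  by (auto simp: L_s_def L_t_def intro: adjoin_base)

lemma vars_in_kxy:
  "i \<in> {1..n} \<Longrightarrow> xvar i \<in> kxy n" "i \<in> {1..n} \<Longrightarrow> yvar i \<in> kxy n"
  by (auto simp: kxy_def intro: adjoin_incl)

lemma elem_sym_in_K_st:
  "j \<in> {1..n} \<Longrightarrow> elem_sym n j xvar \<in> K_st n" "j \<in> {1..n} \<Longrightarrow> elem_sym n j yvar \<in> K_st n"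
  by (auto simp: K_st_def intro: adjoin_incl)

lemma rconst_in_kxy: "rconst c \<in> kxy n"
  by (auto simp: kxy_def intro: adjoin_base)

lemma K_st_subset_kxy: "K_st n \<subseteq> kxy n"
  unfolding K_st_def
proof (rule adjoin_least)
  have *: "elem_sym n j z \<in> kxy n" if "\<And>i. i \<in> {1..n} \<Longrightarrow> z i \<in> kxy n"
    for j and z :: "nat \<Rightarrow> 'a ratfun"
    unfolding elem_sym_def using that
    by (intro subfield_set.sum subfield_set.prod subfield_set_tower) auto
  show "(\<lambda>j. elem_sym n j xvar) ` {1..n} \<union> (\<lambda>j. elem_sym n j yvar) ` {1..n} \<subseteq> (kxy n :: 'a ratfun set)"
    by (auto intro!: * vars_in_kxy simp del: One_nat_def)
qed (auto simp: kxy_def intro: adjoin_base subfield_set_adjoin)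

lemma L_subset_kxy: "L_s n \<subseteq> kxy n" "L_t n \<subseteq> kxy n"
  unfolding L_s_def L_t_def
  by (intro adjoin_least subfield_set_tower K_st_subset_kxy; auto intro: vars_in_kxy simp del: One_nat_def)+

text \<open>Presents \<open>kxy n\<close> as a base field with the roots of one polynomial adjoined,
  the form that \<open>fixed_symmetric\<close> expects.\<close>

lemma kxy_subset_adjoin:
  "kxy n \<subseteq> adjoin (L_s n) (yvar ` {1..n})" "kxy n \<subseteq> adjoin (L_t n) (xvar ` {1..n})"
  unfolding kxy_def[of n]
  by (intro adjoin_least subfield_set_adjoin;
      auto simp: L_s_def L_t_def K_st_def intro: adjoin_base adjoin_incl)+

lemma kxy_eq: "kxy n = adjoin (L_s n) (L_t n)"
proof
  show "kxy n \<subseteq> adjoin (L_s n) (L_t n)"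
    using kxy_subset_adjoin(1) adjoin_mono[of "L_s n" "L_s n" "yvar ` {1..n}" "L_t n"]
    by (auto simp: L_t_def intro: adjoin_incl)
  show "adjoin (L_s n) (L_t n) \<subseteq> kxy n"
    using L_subset_kxy by (intro adjoin_least subfield_set_tower)
qed

context
  fixes n :: nat and \<sigma> \<tau> :: "nat \<Rightarrow> nat"
  assumes \<sigma>: "\<sigma> permutes {1..n}" and \<tau>: "\<tau> permutes {1..n}"
begin

interpretation field_endo "act \<sigma> \<tau>"
  by (intro field_endo_act permutes_bij[OF \<sigma>] permutes_bij[OF \<tau>])

lemmas act_perm = act_xvar[OF permutes_bij[OF \<sigma>] permutes_bij[OF \<tau>]]
  act_yvar[OF permutes_bij[OF \<sigma>] permutes_bij[OF \<tau>]]
  act_rconst[OF permutes_bij[OF \<sigma>] permutes_bij[OF \<tau>]]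

lemma act_K_st: "a \<in> K_st n \<Longrightarrow> act \<sigma> \<tau> a = a"
  unfolding K_st_def
  by (rule fixes_adjoin) (auto simp: act_perm hom_elem_sym[OF \<sigma>] hom_elem_sym[OF \<tau>])

lemma act_kxy: "a \<in> kxy n \<Longrightarrow> act \<sigma> \<tau> a \<in> kxy n"
proof -
  have "kxy n \<subseteq> act \<sigma> \<tau> -` (kxy n :: 'a ratfun set)"
    by (subst kxy_def, intro adjoin_least subfield_set_vimage subfield_set_tower)
      (auto simp: act_perm permutes_in_image[OF \<sigma>] permutes_in_image[OF \<tau>]
        simp del: One_nat_def atLeastAtMost_iff intro!: rconst_in_kxy vars_in_kxy)
  then show "a \<in> kxy n \<Longrightarrow> act \<sigma> \<tau> a \<in> kxy n"
    by auto
qed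

end

lemma act_id_L_s: "\<tau> permutes {1..n} \<Longrightarrow> a \<in> L_s n \<Longrightarrow> act id \<tau> a = a"
  unfolding L_s_def
  by (rule field_endo.fixes_adjoin[OF field_endo_act])
    (auto simp: act_K_st act_xvar permutes_bij permutes_id)

lemma act_id_L_t: "\<sigma> permutes {1..n} \<Longrightarrow> a \<in> L_t n \<Longrightarrow> act \<sigma> id a = a"
  unfolding L_t_def
  by (rule field_endo.fixes_adjoin[OF field_endo_act])
    (auto simp: act_K_st act_yvar permutes_bij permutes_id)

lemma act_id_id:
  assumes "a \<in> kxy n"
  shows "act id id a = a"
  using assms unfolding kxy_def
  by (rule field_endo.fixes_adjoin[OF field_endo_act, rotated -1])
    (auto simp: act_rconst act_xvar act_yvar)

text \<open>The elements at which two endomorphisms agree form a subfield, so comparing the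
  generators of \<open>kxy n\<close> suffices.\<close>

lemma act_comp:
  assumes "\<sigma> permutes {1..n}" "\<tau> permutes {1..n}" "\<sigma>' permutes {1..n}" "\<tau>' permutes {1..n}"
    and "a \<in> kxy n"
  shows "act \<sigma> \<tau> (act \<sigma>' \<tau>' a) = act (\<sigma> \<circ> \<sigma>') (\<tau> \<circ> \<tau>') a"
proof -
  note bij = assms(1-4)[THEN permutes_bij]
  interpret f: field_endo "act \<sigma> \<tau>" using bij by (intro field_endo_act)
  interpret g: field_endo "act \<sigma>' \<tau>'" using bij by (intro field_endo_act)
  interpret h: field_endo "act (\<sigma> \<circ> \<sigma>') (\<tau> \<circ> \<tau>')" using bij by (intro field_endo_act bij_comp)
  have "subfield_set {a. act \<sigma> \<tau> (act \<sigma>' \<tau>' a) = act (\<sigma> \<circ> \<sigma>') (\<tau> \<circ> \<tau>') a}"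
    by unfold_locales
      (auto simp: f.hom_zero f.hom_one f.hom_add f.hom_mult f.hom_uminus f.hom_inverse
        g.hom_zero g.hom_one g.hom_add g.hom_mult g.hom_uminus g.hom_inverse
        h.hom_zero h.hom_one h.hom_add h.hom_mult h.hom_uminus h.hom_inverse)
  then have "kxy n \<subseteq> {a. act \<sigma> \<tau> (act \<sigma>' \<tau>' a) = act (\<sigma> \<circ> \<sigma>') (\<tau> \<circ> \<tau>') (a :: 'a ratfun)}"
    unfolding kxy_def using bij
    by (intro adjoin_least) (auto simp: act_rconst act_xvar act_yvar bij_comp)
  then show ?thesis
    using assms(5) by blast
qed

text \<open>An instance of \<open>fixed_symmetric\<close>: the y variables are the roots of a
  polynomial over \<open>L_s n\<close>, and the required transpositions act through the second
  factor of the group.\<close>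

lemma fixed_field_L_s:
  assumes a: "a \<in> kxy n" and fixed: "\<And>\<tau>. \<tau> permutes {1..n} \<Longrightarrow> act id \<tau> a = a"
  shows "a \<in> L_s n"
proof (rule fixed_symmetric[of "{1..n}" _ yvar])
  show "(\<Prod>i\<in>{1..n}. [:- yvar i, 1:]) \<in> polys_over (L_s n :: 'a ratfun set)"
    by (intro subfield_set.prod_linear_over subfield_set_tower subsetD[OF K_st_subset(1)])
      (auto simp: K_st_def intro: adjoin_incl)
  show "\<exists>h. field_endo h \<and> (\<forall>x\<in>L_s n. h x = x) \<and> h a = a \<and>
      (\<forall>l\<in>{1..n}. h (yvar l) = yvar (transpose i j l))"
    if "i \<in> {1..n}" "j \<in> {1..n}" for i j
    using permutes_swap_id[OF that]
    by (intro exI[of _ "act id (transpose i j)"])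
      (auto intro: field_endo_act act_id_L_s fixed simp: permutes_bij act_yvar)
qed (use a kxy_subset_adjoin(1) subfield_set_tower in \<open>auto simp: inj_on_def\<close>)

lemma fixed_field_L_t:
  assumes a: "a \<in> kxy n" and fixed: "\<And>\<sigma>. \<sigma> permutes {1..n} \<Longrightarrow> act \<sigma> id a = a"
  shows "a \<in> L_t n"
proof (rule fixed_symmetric[of "{1..n}" _ xvar])
  show "(\<Prod>i\<in>{1..n}. [:- xvar i, 1:]) \<in> polys_over (L_t n :: 'a ratfun set)"
    by (intro subfield_set.prod_linear_over subfield_set_tower subsetD[OF K_st_subset(2)])
      (auto simp: K_st_def intro: adjoin_incl)
  show "\<exists>h. field_endo h \<and> (\<forall>x\<in>L_t n. h x = x) \<and> h a = a \<and>
      (\<forall>l\<in>{1..n}. h (xvar l) = xvar (transpose i j l))"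
    if "i \<in> {1..n}" "j \<in> {1..n}" for i j
    using permutes_swap_id[OF that]
    by (intro exI[of _ "act (transpose i j) id"])
      (auto intro: field_endo_act act_id_L_t fixed simp: permutes_bij act_xvar)
qed (use a kxy_subset_adjoin(2) subfield_set_tower in \<open>auto simp: inj_on_def\<close>)

text \<open>Inside \<open>L_s n\<close> the first factor of the group is enough to descend to
  \<open>K_st n\<close>, since only the x variables have been adjoined.\<close>

lemma fixed_field_K_st_in_L_s:
  assumes a: "a \<in> L_s n" and fixed: "\<And>\<sigma>. \<sigma> permutes {1..n} \<Longrightarrow> act \<sigma> id a = a"
  shows "a \<in> K_st n"
proof (rule fixed_symmetric[of "{1..n}" _ xvar])
  show "(\<Prod>i\<in>{1..n}. [:- xvar i, 1:]) \<in> polys_over (K_st n :: 'a ratfun set)"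
    by (intro subfield_set.prod_linear_over subfield_set_tower)
      (auto simp: K_st_def intro: adjoin_incl)
  show "\<exists>h. field_endo h \<and> (\<forall>x\<in>K_st n. h x = x) \<and> h a = a \<and>
      (\<forall>l\<in>{1..n}. h (xvar l) = xvar (transpose i j l))"
    if "i \<in> {1..n}" "j \<in> {1..n}" for i j
    using permutes_swap_id[OF that]
    by (intro exI[of _ "act (transpose i j) id"])
      (auto intro: field_endo_act act_K_st fixed simp: permutes_bij act_xvar permutes_id)
qed (use a subfield_set_tower in \<open>auto simp: inj_on_def L_s_def\<close>)

lemma fixed_field_K_st_in_L_t:
  assumes a: "a \<in> L_t n" and fixed: "\<And>\<tau>. \<tau> permutes {1..n} \<Longrightarrow> act id \<tau> a = a"
  shows "a \<in> K_st n"
proof (rule fixed_symmetric[of "{1..n}" _ yvar])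
  show "(\<Prod>i\<in>{1..n}. [:- yvar i, 1:]) \<in> polys_over (K_st n :: 'a ratfun set)"
    by (intro subfield_set.prod_linear_over subfield_set_tower)
      (auto simp: K_st_def intro: adjoin_incl)
  show "\<exists>h. field_endo h \<and> (\<forall>x\<in>K_st n. h x = x) \<and> h a = a \<and>
      (\<forall>l\<in>{1..n}. h (yvar l) = yvar (transpose i j l))"
    if "i \<in> {1..n}" "j \<in> {1..n}" for i j
    using permutes_swap_id[OF that]
    by (intro exI[of _ "act id (transpose i j)"])
      (auto intro: field_endo_act act_K_st fixed simp: permutes_bij act_yvar permutes_id)
qed (use a subfield_set_tower in \<open>auto simp: inj_on_def L_t_def\<close>)

section \<open>Lagrange coefficients\<close>

lemma act_map_poly_prod_linear:
  assumes "bij \<sigma>" "bij \<tau>"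
  shows "map_poly (act \<sigma> \<tau>) (\<Prod>l\<in>A. [:- xvar l, 1:]) = (\<Prod>l\<in>A. [:- xvar (\<sigma> l), 1 :: 'k::field ratfun:])"
proof -
  interpret field_endo "act \<sigma> \<tau> :: 'k ratfun \<Rightarrow> _"
    using assms by (rule field_endo_act)
  show ?thesis
    using assms by (simp add: map_poly_prod map_poly_linear hom_uminus hom_one act_xvar)
qed

lemma xvar_neq_0: "(xvar i :: 'k::field ratfun) \<noteq> 0"
proof -
  have "Poly_Mapping.lookup (Poly_Mapping.single m (1::'k)) m \<noteq> 0" for m :: "nat \<Rightarrow>\<^sub>0 nat"
    by simp
  then have "Poly_Mapping.single m (1::'k) \<noteq> 0" for m :: "nat \<Rightarrow>\<^sub>0 nat"
    by (metis lookup_zero)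
  then show ?thesis
    by (simp add: xvar_def rvar_def)
qed

lemma coeff_linear_mult:
  "coeff ([:- a, 1:] * q) j = (case j of 0 \<Rightarrow> 0 | Suc i \<Rightarrow> coeff q i) - a * coeff q j"
  for a :: "'a::comm_ring_1"
  by (simp add: coeff_pCons split: nat.split)

text \<open>Relations between the variables are exploited by exchanging a variable with one that does
  not occur in the relation; the ambient field has infinitely many of them.\<close>

lemma coeff_prod_linear_neq_0:
  assumes "finite A" "j \<le> card A"
  shows "coeff (\<Prod>l\<in>A. [:- xvar l, 1 :: 'k::field ratfun:]) j \<noteq> 0"
  using assms
proof (induction A arbitrary: j rule: finite_induct)
  case empty
  then show ?case by simp
next
  case (insert a A)
  define q where "q = (\<Prod>l\<in>A. [:- xvar l, 1 :: 'k ratfun:])"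
  have coeff: "coeff (\<Prod>l\<in>insert a A. [:- xvar l, 1 :: 'k ratfun:]) j
      = (case j of 0 \<Rightarrow> 0 | Suc i \<Rightarrow> coeff q i) - xvar a * coeff q j"
    unfolding prod.insert[OF insert.hyps] q_def[symmetric] by (rule coeff_linear_mult)
  show ?case
  proof (cases j)
    case 0
    then show ?thesis
      using insert.IH[of 0] coeff by (simp add: q_def xvar_neq_0)
  next
    case (Suc i)
    have i: "coeff q i \<noteq> 0"
      using insert.IH[of i] insert.prems insert.hyps Suc by (simp add: q_def)
    obtain b where b: "b \<notin> insert a A"
      using insert.hyps(1) ex_new_if_finite[OF infinite_UNIV_nat, of "insert a A"] by auto
    interpret field_endo "act (transpose a b) id :: 'k ratfun \<Rightarrow> _"
      by (intro field_endo_act) auto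
    have "map_poly (act (transpose a b) id) q = q"
      unfolding q_def using b insert.hyps(2)
      by (subst act_map_poly_prod_linear) (auto intro!: prod.cong simp: transpose_def)
    then have fix_q: "act (transpose a b) id (coeff q m) = coeff q m" for m
      by (metis coeff_map)
    show ?thesis
    proof
      assume "coeff (\<Prod>l\<in>insert a A. [:- xvar l, 1 :: 'k ratfun:]) j = 0"
      then have eq: "coeff q i = xvar a * coeff q j"
        using coeff Suc by simp
      from arg_cong[OF this, of "act (transpose a b) id"]
      have "coeff q i = xvar b * coeff q j"
        by (simp add: hom_mult fix_q act_xvar)
      with eq have "coeff q j = 0"
        using b by auto
      with eq i show False
        by simp
    qed
  qed
qed

definition lagrange_num :: "nat \<Rightarrow> nat \<Rightarrow> 'k::field ratfun poly" where
  "lagrange_num n i = (\<Prod>l\<in>{1..n} - {i}. [:- xvar l, 1:])"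

text \<open>The coefficient at degree \<open>j\<close> of the Lagrange basis polynomial that is 1 at
  \<open>xvar i\<close> and 0 at the other nodes; for fixed \<open>j\<close> these are the c(i) of
  the overview.\<close>

definition lagrange_coeff :: "nat \<Rightarrow> nat \<Rightarrow> nat \<Rightarrow> 'k::field ratfun" where
  "lagrange_coeff n j i = coeff (lagrange_num n i) j / poly (lagrange_num n i) (xvar i)"

lemma poly_lagrange_num_eq_0_iff:
  "poly (lagrange_num n i :: 'k::field ratfun poly) (xvar m) = 0 \<longleftrightarrow> m \<in> {1..n} - {i}"
  by (auto simp: lagrange_num_def poly_prod)

lemma degree_lagrange_num:
  "i \<in> {1..n} \<Longrightarrow> Polynomial.degree (lagrange_num n i :: 'k::field ratfun poly) = n - 1"
  unfolding lagrange_num_def by (subst degree_prod_eq_sum_degree) auto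

text \<open>Only x variables occur, so \<tau> has no effect. That \<sigma> permutes
  \<open>{1..n}\<close> is what preserves the set of nodes.\<close>

lemma act_lagrange_coeff:
  assumes "\<sigma> permutes {1..n}" "bij \<tau>"
  shows "act \<sigma> \<tau> (lagrange_coeff n j i) = (lagrange_coeff n j (\<sigma> i) :: 'k::field ratfun)"
proof -
  have bij: "bij \<sigma>"
    using assms(1) by (rule permutes_bij)
  interpret field_endo "act \<sigma> \<tau> :: 'k ratfun \<Rightarrow> _"
    using bij assms(2) by (rule field_endo_act)
  have "\<sigma> ` ({1..n} - {i}) = {1..n} - {\<sigma> i}"
    using permutes_image[OF assms(1)] bij by (auto simp: image_set_diff bij_is_inj)
  moreover have "inj_on \<sigma> ({1..n} - {i})"
    using bij bij_is_inj inj_on_subset by blast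
  ultimately have num: "map_poly (act \<sigma> \<tau>) (lagrange_num n i) = (lagrange_num n (\<sigma> i) :: 'k ratfun poly)"
    unfolding lagrange_num_def
    by (subst act_map_poly_prod_linear[OF bij assms(2)])
      (metis (no_types, lifting) prod.reindex_cong)
  have "act \<sigma> \<tau> (poly (lagrange_num n i) (xvar i)) = poly (lagrange_num n (\<sigma> i)) (xvar (\<sigma> i) :: 'k ratfun)"
    using poly_map_poly[of "lagrange_num n i" "xvar i"] by (simp add: num act_xvar[OF bij assms(2)])
  then show ?thesis
    by (simp add: lagrange_coeff_def hom_divide num[symmetric] coeff_map)
qed

text \<open>If two Lagrange coefficients agree, clearing denominators gives a polynomial relation
  between \<open>xvar i\<close> and the other variables; viewed as a polynomial in \<open>xvar i\<close> it must vanish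
  identically, which fails at a third variable \<open>xvar l\<close>.\<close>

lemma lagrange_coeff_inj:
  assumes "n \<ge> 3" "j < n" "i \<in> {1..n}" "m \<in> {1..n}"
    and eq: "lagrange_coeff n j i = (lagrange_coeff n j m :: 'k::field ratfun)"
  shows "i = m"
proof (rule ccontr)
  assume "i \<noteq> m"
  have "\<not> {1..n} \<subseteq> {i, m}"
    using assms(1) card_mono[of "{i, m}" "{1..n}"] card_insert_le_m1[of 2 "{m}" i] by auto
  then obtain l where l: "l \<in> {1..n}" "l \<noteq> i" "l \<noteq> m"
    by blast
  define M where "M = (\<Prod>l\<in>{1..n} - {i, m}. [:- xvar l, 1 :: 'k ratfun:])"
  have M0: "poly M (xvar v) = 0 \<longleftrightarrow> v \<in> {1..n} - {i, m}" for v
    by (auto simp: M_def poly_prod)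
  have num: "lagrange_num n i = [:- xvar m, 1:] * M" "lagrange_num n m = [:- xvar i, 1:] * M"
  proof -
    have *: "{1..n} - {i} = insert m ({1..n} - {i, m})" "{1..n} - {m} = insert i ({1..n} - {i, m})"
      using assms(3,4) \<open>i \<noteq> m\<close> by auto
    show "lagrange_num n i = [:- xvar m, 1:] * M" "lagrange_num n m = [:- xvar i, 1:] * M"
      unfolding lagrange_num_def * M_def by (subst prod.insert; simp)+
  qed
  define c where "c = (case j of 0 \<Rightarrow> 0 | Suc i \<Rightarrow> coeff M i)"
  define d where "d = coeff M j"
  define \<kappa> where "\<kappa> = (c - xvar m * d) * poly M (xvar m)"
  have coeff: "coeff (lagrange_num n i) j = c - xvar m * d" "coeff (lagrange_num n m) j = c - xvar i * d"
    unfolding num c_def d_def by (rule coeff_linear_mult)+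
  have "\<kappa> \<noteq> 0"
  proof -
    have "coeff (lagrange_num n i) j \<noteq> (0 :: 'k ratfun)"
      unfolding lagrange_num_def using assms(2,3) by (intro coeff_prod_linear_neq_0) auto
    then show ?thesis
      unfolding \<kappa>_def coeff using M0[of m] by simp
  qed
  \<comment> \<open>The cleared equation with \<open>xvar i\<close> replaced by an indeterminate.
    The quantities \<open>c\<close>, \<open>d\<close>, \<open>M\<close> and \<open>\<kappa>\<close>
    are free of \<open>xvar i\<close>, so exchanging it with \<open>xvar b\<close> turns the root
    \<open>xvar i\<close> into a root \<open>xvar b\<close> for every \<open>b > n\<close>:
    infinitely many roots.\<close>
  define R where "R = [:c, - d:] * M + [:\<kappa>:]"
  have "poly R (xvar i) = 0"
  proof -
    have nz: "poly M (xvar i) \<noteq> 0" "poly M (xvar m) \<noteq> 0" "xvar i - xvar m \<noteq> (0 :: 'k ratfun)"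
      using M0 \<open>i \<noteq> m\<close> by auto
    have "(c - xvar m * d) / ((xvar i - xvar m) * poly M (xvar i))
        = (c - xvar i * d) / ((xvar m - xvar i) * poly M (xvar m))"
      using eq unfolding lagrange_coeff_def coeff by (simp add: num left_diff_distrib)
    also have "\<dots> = - (c - xvar i * d) / ((xvar i - xvar m) * poly M (xvar m))"
      by (subst minus_diff_eq[symmetric, of "xvar m"])
        (simp only: mult_minus_left minus_divide_left[symmetric] minus_divide_right[symmetric])
    finally have "(c - xvar m * d) * poly M (xvar m) = - (c - xvar i * d) * poly M (xvar i)"
      using nz by (simp add: frac_eq_eq)
    then show ?thesis
      by (simp add: R_def \<kappa>_def algebra_simps)
  qed
  have "poly R (xvar b) = 0" if "b > n" for b
  proof -
    let ?h = "act (transpose i b) id :: 'k ratfun \<Rightarrow> _"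
    interpret field_endo ?h
      by (intro field_endo_act) auto
    have "map_poly ?h M = M"
      unfolding M_def using that
      by (subst act_map_poly_prod_linear) (auto intro!: prod.cong simp: transpose_def)
    then have fix_M: "?h (coeff M v) = coeff M v" "?h (poly M x) = poly M (?h x)" for v x
      using coeff_map[of M v] poly_map_poly[of M x] by simp_all
    have vars: "?h (xvar m) = xvar m" "?h (xvar i) = xvar b"
      using \<open>i \<noteq> m\<close> that assms(4) by (simp_all add: act_xvar transpose_def)
    have "?h c = c"
      by (simp add: c_def fix_M(1) hom_zero split: nat.split)
    moreover have "?h d = d"
      by (simp only: d_def fix_M(1))
    ultimately have "?h \<kappa> = \<kappa>"
      by (simp only: \<kappa>_def fix_M(2) hom_mult hom_diff vars)
    have poly_R: "poly R x = (c - x * d) * poly M x + \<kappa>" for x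
      by (simp add: R_def algebra_simps)
    have "?h (poly R (xvar i)) = poly R (xvar b)"
      by (simp only: poly_R hom_add hom_mult hom_diff vars fix_M(2)
          \<open>?h c = c\<close> \<open>?h d = d\<close> \<open>?h \<kappa> = \<kappa>\<close>)
    then show ?thesis
      using \<open>poly R (xvar i) = 0\<close> by (simp add: hom_zero)
  qed
  then have "xvar ` {n<..} \<subseteq> {z. poly R z = 0}"
    by auto
  moreover have "infinite (xvar ` {n<..} :: 'k ratfun set)"
    by (subst finite_image_iff) (auto simp: inj_on_def infinite_Ioi)
  ultimately have "R = 0"
    using poly_roots_finite finite_subset by blast
  then have "poly R (xvar l) = 0"
    by simp
  then have "\<kappa> = 0"
    using l M0[of l] by (simp add: R_def)
  with \<open>\<kappa> \<noteq> 0\<close> show False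
    by simp
qed

text \<open>The last hypothesis says in usable form that no y variable occurs in the
  \<open>d i\<close>. Exchanging \<open>yvar k\<close> with a fresh \<open>yvar b\<close> and
  subtracting leaves \<open>(yvar k - yvar b) * d k = 0\<close>.\<close>

lemma yvar_independent:
  fixes d :: "nat \<Rightarrow> 'k::field ratfun"
  assumes "finite A" "(\<Sum>i\<in>A. yvar i * d i) = 0" "k \<in> A"
    and d: "\<And>i \<tau>. i \<in> A \<Longrightarrow> bij \<tau> \<Longrightarrow> act id \<tau> (d i) = d i"
  shows "d k = 0"
proof -
  obtain b where b: "b \<notin> A"
    using assms(1) ex_new_if_finite[OF infinite_UNIV_nat] by blast
  let ?h = "act id (transpose k b) :: 'k ratfun \<Rightarrow> _"
  interpret field_endo ?h
    by (intro field_endo_act) auto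
  let ?S = "\<Sum>i\<in>A - {k}. yvar i * d i"
  have S: "yvar k * d k + ?S = 0"
    using assms(1-3) by (simp add: sum.remove)
  have "?h ?S = ?S"
    unfolding hom_sum using b
    by (intro sum.cong) (auto simp: hom_mult act_yvar d transpose_def)
  moreover have "?h (yvar k * d k) = yvar b * d k"
    using assms(3) by (simp add: hom_mult act_yvar d)
  ultimately have "yvar b * d k + ?S = 0"
    using arg_cong[OF S, of ?h] by (simp add: hom_add hom_zero)
  with S have "yvar k * d k + ?S = yvar b * d k + ?S"
    by (simp only:)
  then have "yvar k * d k = yvar b * d k"
    by (rule add_right_imp_eq)
  then show ?thesis
    using b assms(3) by auto
qed

text \<open>The polynomial with coefficients \<open>v j\<close> and the Lagrange interpolation
  polynomial have degree below \<open>n\<close> and agree at the \<open>n\<close> nodes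
  \<open>xvar (\<rho> i)\<close>, so their coefficients coincide.\<close>

lemma interpolation_lagrange:
  fixes v :: "nat \<Rightarrow> 'k::field ratfun"
  assumes \<rho>: "\<rho> permutes {1..n}" and "n > 0"
    and v: "\<And>i. i \<in> {1..n} \<Longrightarrow> yvar i = (\<Sum>j<n. v j * xvar (\<rho> i) ^ j)" and "j < n"
  shows "v j = (\<Sum>i\<in>{1..n}. yvar i * lagrange_coeff n j (\<rho> i))"
proof -
  define V where "V = (\<Sum>j<n. monom (v j) j)"
  define W where "W = (\<Sum>i\<in>{1..n}. Polynomial.smult (yvar i / poly (lagrange_num n (\<rho> i)) (xvar (\<rho> i)))
    (lagrange_num n (\<rho> i) :: 'k ratfun poly))"
  have \<rho>_in: "\<rho> i \<in> {1..n}" if "i \<in> {1..n}" for i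
    using permutes_in_image[OF \<rho>] that by blast
  have inj\<rho>: "\<rho> i = \<rho> k \<longleftrightarrow> i = k" for i k
    using permutes_inj[OF \<rho>] by (auto dest: injD)
  have "V = W"
  proof (rule poly_eqI_degree[of "(\<lambda>i. xvar (\<rho> i)) ` {1..n}"])
    fix x assume "x \<in> (\<lambda>i. xvar (\<rho> i) :: 'k ratfun) ` {1..n}"
    then obtain k where k: "k \<in> {1..n}" "x = xvar (\<rho> k)"
      by blast
    have "poly W x = (\<Sum>i\<in>{1..n}. if i = k then yvar k else 0)"
      unfolding W_def poly_sum k(2)
    proof (rule sum.cong[OF refl])
      fix i assume i: "i \<in> {1..n}"
      show "poly (Polynomial.smult (yvar i / poly (lagrange_num n (\<rho> i)) (xvar (\<rho> i)))
          (lagrange_num n (\<rho> i))) (xvar (\<rho> k)) = (if i = k then yvar k else (0 :: 'k ratfun))"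
        using poly_lagrange_num_eq_0_iff[of n "\<rho> i" "\<rho> k", where 'k='k] \<rho>_in[OF k(1)] inj\<rho>
        by (auto simp: poly_lagrange_num_eq_0_iff)
    qed
    then show "poly V x = poly W x"
      using v[OF k(1)] k by (simp add: V_def poly_sum poly_monom)
  next
    have card: "card ((\<lambda>i. xvar (\<rho> i) :: 'k ratfun) ` {1..n}) = n"
      by (subst card_image) (auto simp: inj_on_def inj\<rho>)
    have "Polynomial.degree V \<le> n - 1"
      unfolding V_def by (intro degree_sum_le) (auto intro: order.trans[OF degree_monom_le])
    moreover have "Polynomial.degree W \<le> n - 1"
      unfolding W_def
      by (intro degree_sum_le) (auto intro!: order.trans[OF degree_smult_le] simp: degree_lagrange_num[OF \<rho>_in])
    ultimately show "Polynomial.degree V < card ((\<lambda>i. xvar (\<rho> i) :: 'k ratfun) ` {1..n})"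
      "Polynomial.degree W < card ((\<lambda>i. xvar (\<rho> i) :: 'k ratfun) ` {1..n})"
      using card \<open>n > 0\<close> by linarith+
  qed
  have "coeff V j = v j"
    using \<open>j < n\<close> by (simp add: V_def coeff_sum)
  with \<open>V = W\<close> show ?thesis
    by (simp add: W_def coeff_sum lagrange_coeff_def)
qed

section \<open>The conjugates of the solution\<close>

text \<open>Interpolation with the data given as a finite graph \<open>T\<close>, so that invariance
  of the data under an endomorphism can be stated without indices.\<close>

lemma polynomial_interpolation_ex:
  fixes E :: "'a::field set"
  assumes "finite T" "inj_on fst T" "T \<subseteq> E \<times> E" "subfield_set E"
  shows "\<exists>p\<in>polys_over E. (\<forall>j\<ge>card T. coeff p j = 0) \<and> (\<forall>t\<in>T. poly p (fst t) = snd t)"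
proof -
  have E: "adjoin E {} = E"
    using adjoin_least[of E E "{}"] assms(4) by (auto intro: adjoin_base)
  obtain f where f: "bij_betw f {1..card T} T"
    using ex_bij_betw_nat_finite_1[OF assms(1)] by blast
  have mem: "fst (f i) \<in> E \<and> snd (f i) \<in> E" if "i \<in> {1..card T}" for i
    using bij_betwE[OF f] that assms(3) by force
  have "inj_on (fst \<circ> f) {1..card T}"
    using f assms(2) by (auto simp: bij_betw_def intro: comp_inj_on)
  from interpolation_exists[OF this, of E "{}" "snd \<circ> f"] mem
  obtain p where p: "\<forall>j. coeff p j \<in> E" "\<forall>j\<ge>card T. coeff p j = 0"
      "\<forall>i\<in>{1..card T}. poly p (fst (f i)) = snd (f i)"
    by (auto simp: E)
  have "\<forall>t\<in>f ` {1..card T}. poly p (fst t) = snd t"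
    using p(3) by blast
  then have "\<forall>t\<in>T. poly p (fst t) = snd t"
    by (simp only: bij_betw_imp_surj_on[OF f])
  with p(1,2) show ?thesis
    by (intro bexI[of _ p]) (simp_all add: polys_over_def)
qed

text \<open>\<open>T\<close> is meant to be the set of pairs of conjugates of \<open>(\<theta>, a)\<close>. The polynomial interpolating it
  is invariant by uniqueness, hence has coefficients in the fixed field, and its value at \<open>\<theta>\<close>
  is \<open>a\<close>.\<close>

lemma primitive_element:
  fixes E :: "'a::field set"
  assumes T: "finite T" "inj_on fst T" "T \<subseteq> E \<times> E" "(\<theta>, a) \<in> T" and E: "subfield_set E"
    and H: "\<And>h. h \<in> H \<Longrightarrow> field_endo h" "\<And>h b c. h \<in> H \<Longrightarrow> (b, c) \<in> T \<Longrightarrow> (h b, h c) \<in> T"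
    and fixed: "\<And>x. x \<in> E \<Longrightarrow> (\<And>h. h \<in> H \<Longrightarrow> h x = x) \<Longrightarrow> x \<in> F"
  shows "a \<in> adjoin F {\<theta>}"
proof -
  obtain p where p: "p \<in> polys_over E" "\<And>j. j \<ge> card T \<Longrightarrow> coeff p j = 0"
      "\<And>t. t \<in> T \<Longrightarrow> poly p (fst t) = snd t"
    using polynomial_interpolation_ex[OF T(1-3) E] by blast
  have cardT: "card (fst ` T) = card T"
    by (rule card_image) fact
  have degree: "Polynomial.degree q < card T" if "\<And>j. j \<ge> card T \<Longrightarrow> coeff q j = 0" for q :: "'a poly"
  proof (cases "q = 0")
    case True
    then show ?thesis
      using T(1,4) by (auto simp: card_gt_0_iff)
  next
    case False
    then show ?thesis
      using that by (intro degree_less_if_coeffs_0) auto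
  qed
  have "coeff p j \<in> F" for j
  proof (rule fixed)
    show "coeff p j \<in> E"
      using p(1) by (rule polys_overD)
  next
    fix h assume h: "h \<in> H"
    interpret field_endo h
      using h by (rule H(1))
    define h2 where "h2 = map_prod h h"
    have "inj_on h2 T"
      by (intro inj_onI) (auto simp: h2_def hom_inj)
    moreover have "h2 ` T \<subseteq> T"
      using H(2)[OF h] by (auto simp: h2_def)
    ultimately have img: "h2 ` T = T"
      using T(1) by (intro endo_inj_surj)
    have "map_poly h p = p"
    proof (rule poly_eqI_degree[of "fst ` T"])
      fix x assume "x \<in> fst ` T"
      then have "x \<in> fst ` h2 ` T"
        by (simp only: img)
      then obtain t where t: "t \<in> T" "x = fst (h2 t)"
        by (elim imageE) simp
      then have "h2 t \<in> T"
        using imageI[of t T h2] by (simp only: img)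
      have "poly (map_poly h p) x = h (poly p (fst t))"
        using poly_map_poly[of p "fst t"] t(2) by (simp add: h2_def)
      also have "\<dots> = snd (h2 t)"
        using p(3)[OF t(1)] by (simp add: h2_def)
      also have "\<dots> = poly p x"
        using p(3)[OF \<open>h2 t \<in> T\<close>] t(2) by simp
      finally show "poly (map_poly h p) x = poly p x" .
    qed (use p(2) in \<open>auto simp: cardT coeff_map hom_zero intro!: degree\<close>)
    then show "h (coeff p j) = coeff p j"
      by (metis coeff_map)
  qed
  then have "p \<in> polys_over (adjoin F {\<theta>})"
    by (auto simp: polys_over_def intro: adjoin_base)
  then have "poly p \<theta> \<in> adjoin F {\<theta>}"
    by (intro subfield_set.poly_in subfield_set_adjoin) (auto intro: adjoin_incl)
  then show ?thesis
    using p(3)[OF T(4)] by simp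
qed

text \<open>Abstracts the conjugates \<open>g (u_st n j)\<close>: all that is retained of
  \<open>g\<close> is the permutation \<rho> pairing the nodes with the values.\<close>

locale permuted_solution =
  fixes n :: nat and \<rho> :: "nat \<Rightarrow> nat" and v :: "nat \<Rightarrow> 'k::field ratfun"
  assumes n: "n \<ge> 3" and \<rho>: "\<rho> permutes {1..n}"
    and v_kxy: "\<And>j. j < n \<Longrightarrow> v j \<in> kxy n"
    and v: "\<And>i. i \<in> {1..n} \<Longrightarrow> yvar i = (\<Sum>j<n. v j * xvar (\<rho> i) ^ j)"
begin

lemma v_lagrange: "j < n \<Longrightarrow> v j = (\<Sum>i\<in>{1..n}. yvar i * lagrange_coeff n j (\<rho> i))"
  using n by (intro interpolation_lagrange[OF \<rho>] v) auto

text \<open>The pair (\<sigma>, \<tau>) replaces \<rho> by \<sigma> \<rho> \<tau>^-1: reindexing the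
  sum by \<tau> restores \<open>yvar i\<close> and moves the inverse of \<tau> into the
  coefficient.\<close>

lemma act_v:
  assumes "\<sigma> permutes {1..n}" "\<tau> permutes {1..n}" "j < n"
  shows "act \<sigma> \<tau> (v j) = (\<Sum>i\<in>{1..n}. yvar i * lagrange_coeff n j ((\<sigma> \<circ> \<rho> \<circ> inv_into UNIV \<tau>) i))"
proof -
  note bij = assms(1,2)[THEN permutes_bij]
  interpret field_endo "act \<sigma> \<tau> :: 'k ratfun \<Rightarrow> _"
    using bij by (rule field_endo_act)
  have "act \<sigma> \<tau> (v j) = (\<Sum>i\<in>{1..n}. yvar (\<tau> i) * lagrange_coeff n j (\<sigma> (\<rho> i)))"
    using bij by (simp add: v_lagrange[OF assms(3)] hom_sum hom_mult act_yvar act_lagrange_coeff[OF assms(1)])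
  also have "\<dots> = (\<Sum>i\<in>{1..n}. yvar i * lagrange_coeff n j ((\<sigma> \<circ> \<rho> \<circ> inv_into UNIV \<tau>) i))"
    by (subst (2) sum.permute[OF assms(2)]) (simp add: o_def permutes_inverses[OF assms(2)])
  finally show ?thesis .
qed

text \<open>Comparing the coefficients of each \<open>yvar i\<close> is legitimate by
  \<open>yvar_independent\<close>; \<open>lagrange_coeff_inj\<close> then recovers the permutation
  from them.\<close>

lemma act_v_eqD:
  assumes perm: "\<sigma> permutes {1..n}" "\<tau> permutes {1..n}" "\<sigma>' permutes {1..n}" "\<tau>' permutes {1..n}"
    and "j < n" and eq: "act \<sigma> \<tau> (v j) = act \<sigma>' \<tau>' (v j)"
  shows "\<sigma> \<circ> \<rho> \<circ> inv_into UNIV \<tau> = \<sigma>' \<circ> \<rho> \<circ> inv_into UNIV \<tau>'"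
proof
  define f where "f = \<sigma> \<circ> \<rho> \<circ> inv_into UNIV \<tau>"
  define f' where "f' = \<sigma>' \<circ> \<rho> \<circ> inv_into UNIV \<tau>'"
  have f: "f permutes {1..n}" "f' permutes {1..n}"
    unfolding f_def f'_def using perm \<rho> by (auto intro!: permutes_compose permutes_inv)
  have "(\<Sum>i\<in>{1..n}. yvar i * (lagrange_coeff n j (f i) - lagrange_coeff n j (f' i))) = (0 :: 'k ratfun)"
    using eq[unfolded act_v[OF perm(1,2) \<open>j < n\<close>] act_v[OF perm(3,4) \<open>j < n\<close>], folded f_def f'_def]
    by (simp add: right_diff_distrib sum_subtractf)
  then have "lagrange_coeff n j (f i) - lagrange_coeff n j (f' i) = (0 :: 'k ratfun)" if "i \<in> {1..n}" for i
  proof (rule yvar_independent[OF finite_atLeastAtMost _ that])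
    fix k :: nat and \<tau> :: "nat \<Rightarrow> nat" assume "bij \<tau>"
    interpret field_endo "act id \<tau> :: 'k ratfun \<Rightarrow> _"
      using \<open>bij \<tau>\<close> by (intro field_endo_act) auto
    show "act id \<tau> (lagrange_coeff n j (f k) - lagrange_coeff n j (f' k))
        = (lagrange_coeff n j (f k) - lagrange_coeff n j (f' k) :: 'k ratfun)"
      by (simp add: hom_diff act_lagrange_coeff[OF permutes_id \<open>bij \<tau>\<close>])
  qed
  then have "lagrange_coeff n j (f i) = (lagrange_coeff n j (f' i) :: 'k ratfun)" if "i \<in> {1..n}" for i
    using that by (simp only: right_minus_eq)
  moreover have "f i \<in> {1..n}" "f' i \<in> {1..n}" if "i \<in> {1..n}" for i
    using that permutes_in_image[OF f(1)] permutes_in_image[OF f(2)] by blast+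
  ultimately have "f i = f' i" if "i \<in> {1..n}" for i
    using that by (intro lagrange_coeff_inj[OF n \<open>j < n\<close>, where 'k='k])
  moreover have "f i = f' i" if "i \<notin> {1..n}" for i
    using that f by (simp add: permutes_not_in)
  ultimately show "f i = f' i" for i
    by blast
qed

text \<open>With \<sigma> = id the permutation \<rho> \<tau>^-1 determines \<tau>, so the images of
  \<open>v j\<close> under the second factor are pairwise distinct. Hence the orbit \<open>T\<close>
  of \<open>(v j, a)\<close> is the graph of a function, as \<open>primitive_element\<close>
  demands.\<close>

lemma adjoin_L_s:
  assumes "j < n"
  shows "adjoin (L_s n) {v j} = kxy n"
proof
  show "adjoin (L_s n) {v j} \<subseteq> kxy n"
    using L_subset_kxy(1) v_kxy[OF assms] by (intro adjoin_least subfield_set_tower) auto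
  show "kxy n \<subseteq> adjoin (L_s n) {v j}"
  proof
    fix a :: "'k ratfun" assume a: "a \<in> kxy n"
    let ?P = "{\<tau>. \<tau> permutes {1..n}}"
    define T where "T = (\<lambda>\<tau>. (act id \<tau> (v j), act id \<tau> a)) ` ?P"
    show "a \<in> adjoin (L_s n) {v j}"
    proof (rule primitive_element[where T = T and E = "kxy n" and H = "act id ` ?P"])
      show "finite T"
        by (simp add: T_def finite_permutations)
      have "\<tau> = \<tau>'" if perm: "\<tau> permutes {1..n}" "\<tau>' permutes {1..n}"
        and "act id \<tau> (v j) = act id \<tau>' (v j)" for \<tau> \<tau>'
      proof -
        have "\<rho> \<circ> inv_into UNIV \<tau> = \<rho> \<circ> inv_into UNIV \<tau>'"
          using act_v_eqD[OF permutes_id perm(1) permutes_id perm(2) assms that(3)] by simp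
        then have "inv_into UNIV \<tau> = inv_into UNIV \<tau>'"
          using permutes_inj[OF \<rho>] by (simp add: fun_eq_iff inj_eq)
        then show ?thesis
          using perm by (metis inv_inv_eq permutes_bij)
      qed
      then show "inj_on fst T"
        by (auto simp: T_def inj_on_def)
      show "T \<subseteq> kxy n \<times> kxy n"
        using a v_kxy[OF assms] by (auto simp: T_def intro: act_kxy permutes_id)
      show "(v j, a) \<in> T"
        unfolding T_def using a v_kxy[OF assms]
        by (intro image_eqI[of _ _ id]) (auto simp: permutes_id act_id_id)
      show "(h b, h c) \<in> T" if "h \<in> act id ` ?P" "(b, c) \<in> T" for h b c
        using that a v_kxy[OF assms] unfolding T_def
        by (force simp: act_comp permutes_id intro: permutes_compose)
      show "x \<in> L_s n" if "x \<in> kxy n" "\<And>h. h \<in> act id ` ?P \<Longrightarrow> h x = x" for x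
        using that by (intro fixed_field_L_s) auto
    qed (auto intro: field_endo_act subfield_set_tower permutes_bij)
  qed
qed

text \<open>The same with \<tau> = id: here \<sigma> \<rho> determines \<sigma>.\<close>

lemma adjoin_L_t:
  assumes "j < n"
  shows "adjoin (L_t n) {v j} = kxy n"
proof
  show "adjoin (L_t n) {v j} \<subseteq> kxy n"
    using L_subset_kxy(2) v_kxy[OF assms] by (intro adjoin_least subfield_set_tower) auto
  show "kxy n \<subseteq> adjoin (L_t n) {v j}"
  proof
    fix a :: "'k ratfun" assume a: "a \<in> kxy n"
    let ?P = "{\<sigma>. \<sigma> permutes {1..n}}"
    define T where "T = (\<lambda>\<sigma>. (act \<sigma> id (v j), act \<sigma> id a)) ` ?P"
    show "a \<in> adjoin (L_t n) {v j}"
    proof (rule primitive_element[where T = T and E = "kxy n" and H = "(\<lambda>\<sigma>. act \<sigma> id) ` ?P"])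
      show "finite T"
        by (simp add: T_def finite_permutations)
      have "\<sigma> = \<sigma>'" if perm: "\<sigma> permutes {1..n}" "\<sigma>' permutes {1..n}"
        and "act \<sigma> id (v j) = act \<sigma>' id (v j)" for \<sigma> \<sigma>'
      proof -
        have "\<sigma> \<circ> \<rho> = \<sigma>' \<circ> \<rho>"
          using act_v_eqD[OF perm(1) permutes_id perm(2) permutes_id assms that(3)] by simp
        then show ?thesis
          using permutes_surj[OF \<rho>] by (metis fun.map_comp o_id surj_iff comp_assoc)
      qed
      then show "inj_on fst T"
        by (auto simp: T_def inj_on_def)
      show "T \<subseteq> kxy n \<times> kxy n"
        using a v_kxy[OF assms] by (auto simp: T_def intro: act_kxy permutes_id)
      show "(v j, a) \<in> T"
        unfolding T_def using a v_kxy[OF assms]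
        by (intro image_eqI[of _ _ id]) (auto simp: permutes_id act_id_id)
      show "(h b, h c) \<in> T" if "h \<in> (\<lambda>\<sigma>. act \<sigma> id) ` ?P" "(b, c) \<in> T" for h b c
        using that a v_kxy[OF assms] unfolding T_def
        by (force simp: act_comp permutes_id intro: permutes_compose)
      show "x \<in> L_t n" if "x \<in> kxy n" "\<And>h. h \<in> (\<lambda>\<sigma>. act \<sigma> id) ` ?P \<Longrightarrow> h x = x" for x
        using that by (intro fixed_field_L_t) auto
    qed (auto intro: field_endo_act subfield_set_tower permutes_bij)
  qed
qed

lemma act_v_conjugate:
  assumes perm: "\<sigma> permutes {1..n}" "\<tau> permutes {1..n}" and comm: "\<sigma> \<circ> \<rho> = \<rho> \<circ> \<tau>"
    and "j < n" and a: "a \<in> adjoin (K_st n) {v j}"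
  shows "act \<sigma> \<tau> a = a"
proof (rule field_endo.fixes_adjoin[OF field_endo_act _ _ a])
  show "bij \<sigma>" "bij \<tau>"
    using perm by (auto intro: permutes_bij)
  show "act \<sigma> \<tau> b = b" if "b \<in> K_st n" for b
    using that perm by (intro act_K_st)
  have "\<sigma> \<circ> \<rho> \<circ> inv_into UNIV \<tau> = \<rho>"
    using comm permutes_inv_o(1)[OF perm(2)] by (simp add: comp_assoc)
  then have "act \<sigma> \<tau> (v j) = v j"
    using act_v[OF perm \<open>j < n\<close>] v_lagrange[OF \<open>j < n\<close>] by simp
  then show "act \<sigma> \<tau> b = b" if "b \<in> {v j}" for b
    using that by simp
qed

text \<open>For each \<sigma> there is a \<tau> such that (\<sigma>, \<tau>) fixes
  \<open>v j\<close>, hence \<open>a\<close>. It factors as (\<sigma>, id) after (id, \<tau>), and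
  the latter is trivial on \<open>L_s n\<close>; so (\<sigma>, id) fixes \<open>a\<close>, for
  arbitrary \<sigma>.\<close>

lemma L_s_inter:
  assumes "j < n"
  shows "L_s n \<inter> adjoin (K_st n) {v j} = K_st n"
proof
  show "L_s n \<inter> adjoin (K_st n) {v j} \<subseteq> K_st n"
  proof
    fix a assume a: "a \<in> L_s n \<inter> adjoin (K_st n) {v j}"
    show "a \<in> K_st n"
    proof (rule fixed_field_K_st_in_L_s)
      fix \<sigma> assume \<sigma>: "\<sigma> permutes {1..n}"
      \<comment> \<open>The solution of \<sigma> \<rho> = \<rho> \<tau>, the condition for fixing
        \<open>v j\<close>.\<close>
      define \<tau> where "\<tau> = inv_into UNIV \<rho> \<circ> \<sigma> \<circ> \<rho>"
      have \<tau>: "\<tau> permutes {1..n}"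
        unfolding \<tau>_def using \<sigma> \<rho> by (intro permutes_compose permutes_inv)
      have "\<sigma> \<circ> \<rho> = \<rho> \<circ> \<tau>"
        using permutes_inv_o(1)[OF \<rho>] by (simp add: \<tau>_def comp_assoc[symmetric])
      then have "act \<sigma> \<tau> a = a"
        using \<sigma> \<tau> a assms by (intro act_v_conjugate) auto
      moreover have "act \<sigma> id (act id \<tau> a) = act \<sigma> \<tau> a"
        using \<sigma> \<tau> a L_subset_kxy(1) by (subst act_comp) (auto simp: permutes_id)
      ultimately show "act \<sigma> id a = a"
        using act_id_L_s[OF \<tau>, of a] a by simp
    qed (use a in auto)
  qed
qed (use K_st_subset in \<open>auto intro: adjoin_base\<close>)

lemma L_t_inter:
  assumes "j < n"
  shows "L_t n \<inter> adjoin (K_st n) {v j} = K_st n"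
proof
  show "L_t n \<inter> adjoin (K_st n) {v j} \<subseteq> K_st n"
  proof
    fix a assume a: "a \<in> L_t n \<inter> adjoin (K_st n) {v j}"
    show "a \<in> K_st n"
    proof (rule fixed_field_K_st_in_L_t)
      fix \<tau> assume \<tau>: "\<tau> permutes {1..n}"
      \<comment> \<open>The same condition, now solved for \<sigma>; this time (\<sigma>, id) is the
        factor that acts trivially, on \<open>L_t n\<close>.\<close>
      define \<sigma> where "\<sigma> = \<rho> \<circ> \<tau> \<circ> inv_into UNIV \<rho>"
      have \<sigma>: "\<sigma> permutes {1..n}"
        unfolding \<sigma>_def using \<tau> \<rho> by (intro permutes_compose permutes_inv)
      have "\<sigma> \<circ> \<rho> = \<rho> \<circ> \<tau>"
        using permutes_inv_o(2)[OF \<rho>] by (simp add: \<sigma>_def comp_assoc)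
      then have "act \<sigma> \<tau> a = a"
        using \<sigma> \<tau> a assms by (intro act_v_conjugate) auto
      moreover have "act id \<tau> (act \<sigma> id a) = act \<sigma> \<tau> a"
        using \<sigma> \<tau> a L_subset_kxy(2) by (subst act_comp) (auto simp: permutes_id)
      ultimately show "act id \<tau> a = a"
        using act_id_L_t[OF \<sigma>, of a] a by simp
    qed (use a in auto)
  qed
qed (use K_st_subset in \<open>auto intro: adjoin_base\<close>)

end

section \<open>Elements of the Galois group as pairs of permutations\<close>

context
  fixes g :: "'k::field ratfun \<Rightarrow> 'k ratfun" and n :: nat
  assumes g: "g \<in> G_st n"
begin

lemma G_st_hom:
  "a \<in> kxy n \<Longrightarrow> g a \<in> kxy n"
  "a \<in> kxy n \<Longrightarrow> b \<in> kxy n \<Longrightarrow> g (a + b) = g a + g b"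
  "a \<in> kxy n \<Longrightarrow> b \<in> kxy n \<Longrightarrow> g (a * b) = g a * g b"
  "inj_on g (kxy n)"
  "a \<in> K_st n \<Longrightarrow> g a = a"
  using g by (auto simp: G_st_def Gal_def ring_iso_def ring_hom_def bij_betw_def)

interpretation kxy: subfield_set "kxy n :: 'k ratfun set"
  by (rule subfield_set_tower)

interpretation K: subfield_set "K_st n :: 'k ratfun set"
  by (rule subfield_set_tower)

lemma G_st_0: "g 0 = 0" and G_st_1: "g 1 = 1"
  using G_st_hom(5) K.zero K.one by auto

lemma G_st_sum: "(\<And>i. i \<in> I \<Longrightarrow> f i \<in> kxy n) \<Longrightarrow> g (sum f I) = (\<Sum>i\<in>I. g (f i))"
  by (induction I rule: infinite_finite_induct) (auto simp: G_st_0 G_st_hom(2) kxy.sum)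

lemma G_st_power: "a \<in> kxy n \<Longrightarrow> g (a ^ m) = g a ^ m"
  by (induction m) (auto simp: G_st_1 G_st_hom(3) kxy.power)

text \<open>Since \<open>g\<close> is a homomorphism on \<open>kxy n\<close> only, the facts on
  \<open>field_endo\<close> do not apply to it; this substitute suffices to send roots to
  roots.\<close>

lemma G_st_poly:
  assumes "p \<in> polys_over (K_st n)" "z \<in> kxy n"
  shows "g (poly p z) = poly p (g z)"
proof -
  have "coeff p j \<in> kxy n" for j
    using polys_overD[OF assms(1)] K_st_subset_kxy by blast
  then show ?thesis
    using assms(2) polys_overD[OF assms(1)]
    by (simp add: poly_altdef G_st_sum G_st_hom(3,5) G_st_power kxy.mult kxy.power)
qed

lemma G_st_permutes_roots:
  assumes z: "\<And>i. i \<in> {1..n} \<Longrightarrow> z i \<in> kxy n" "inj_on z {1..n}"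
    and "\<And>j. j \<in> {1..n} \<Longrightarrow> elem_sym n j z \<in> K_st n"
  shows "\<exists>\<sigma>. \<sigma> permutes {1..n} \<and> (\<forall>i\<in>{1..n}. g (z i) = z (\<sigma> i))"
proof -
  define p where "p = (\<Prod>i\<in>{1..n}. [:- z i, 1:])"
  have p: "p \<in> polys_over (K_st n)"
    unfolding p_def using assms(3) by (rule K.prod_linear_over)
  have "\<exists>l\<in>{1..n}. g (z i) = z l" if "i \<in> {1..n}" for i
  proof -
    have "poly p (z i) = 0"
      using that by (auto simp: p_def poly_prod)
    then have "poly p (g (z i)) = 0"
      using G_st_poly[OF p z(1)[OF that]] by (simp add: G_st_0)
    then show ?thesis
      by (simp add: p_def poly_prod)
  qed
  then obtain f where f: "\<And>i. i \<in> {1..n} \<Longrightarrow> f i \<in> {1..n} \<and> g (z i) = z (f i)"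
    by metis
  have "inj_on f {1..n}"
  proof (rule inj_onI)
    fix i l assume il: "i \<in> {1..n}" "l \<in> {1..n}" "f i = f l"
    then have "g (z i) = g (z l)"
      using f by simp
    then show "i = l"
      using il z G_st_hom(4) by (meson inj_onD)
  qed
  moreover from this have "f ` {1..n} = {1..n}"
    using f by (intro endo_inj_surj) auto
  ultimately have "bij_betw f {1..n} {1..n}"
    by (simp add: bij_betw_def)
  \<comment> \<open>\<open>f\<close> is unspecified outside \<open>{1..n}\<close>, whereas
    \<open>permutes\<close> demands the identity there.\<close>
  then have "bij_betw (\<lambda>i. if i \<in> {1..n} then f i else i) {1..n} {1..n}"
    by (subst bij_betw_cong[of _ _ f]) simp_all
  then have "(\<lambda>i. if i \<in> {1..n} then f i else i) permutes {1..n}"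
    by (rule bij_imp_permutes) auto
  then show ?thesis
    using f by (intro exI[of _ "\<lambda>i. if i \<in> {1..n} then f i else i"]) auto
qed

lemma G_st_permuted_solution:
  assumes "n \<ge> 3"
  obtains \<rho> where "permuted_solution n \<rho> (\<lambda>j. g (u_st n j))"
proof -
  have u: "u_st n j \<in> (kxy n :: 'k ratfun set)" if "j < n" for j
    using is_solution_u_st that by (auto simp: is_solution_def)
  obtain \<sigma> where \<sigma>: "\<sigma> permutes {1..n}" "\<And>i. i \<in> {1..n} \<Longrightarrow> g (xvar i) = xvar (\<sigma> i)"
    using G_st_permutes_roots[of xvar, OF vars_in_kxy(1) _ elem_sym_in_K_st(1)]
    by (auto simp: inj_on_def)
  obtain \<tau> where \<tau>: "\<tau> permutes {1..n}" "\<And>i. i \<in> {1..n} \<Longrightarrow> g (yvar i) = yvar (\<tau> i)"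
    using G_st_permutes_roots[of yvar, OF vars_in_kxy(2) _ elem_sym_in_K_st(2)]
    by (auto simp: inj_on_def)
  have "permuted_solution n (\<sigma> \<circ> inv_into UNIV \<tau>) (\<lambda>j. g (u_st n j))"
  proof
    show "\<sigma> \<circ> inv_into UNIV \<tau> permutes {1..n}"
      using \<sigma>(1) \<tau>(1) by (intro permutes_compose permutes_inv)
    show "g (u_st n j) \<in> kxy n" if "j < n" for j
      using G_st_hom(1) u that by blast
    fix i assume i: "i \<in> {1..n}"
    \<comment> \<open>\<open>g\<close> is applied to the equation with number \<open>l\<close>,
      chosen so that its left-hand side becomes \<open>yvar i\<close>; the node
      \<open>xvar l\<close> then becomes \<open>xvar (\<sigma> l)\<close>.\<close>
    define l where "l = inv_into UNIV \<tau> i"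
    have l: "l \<in> {1..n}" "\<tau> l = i"
      using i permutes_in_image[OF permutes_inv[OF \<tau>(1)]] permutes_inverses(1)[OF \<tau>(1)]
      by (auto simp: l_def)
    have x: "xvar l \<in> (kxy n :: 'k ratfun set)"
      using l(1) by (rule vars_in_kxy)
    have "g (yvar l) = g (\<Sum>j<n. u_st n j * xvar l ^ j)"
      by (simp only: is_solution_eq[OF is_solution_u_st l(1)])
    also have "\<dots> = (\<Sum>j<n. g (u_st n j * xvar l ^ j))"
      using u x by (intro G_st_sum kxy.mult kxy.power) auto
    also have "\<dots> = (\<Sum>j<n. g (u_st n j) * g (xvar l) ^ j)"
      using u x by (intro sum.cong refl) (simp add: G_st_hom(3) G_st_power kxy.power)
    finally show "yvar i = (\<Sum>j<n. g (u_st n j) * xvar ((\<sigma> \<circ> inv_into UNIV \<tau>) i) ^ j)"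
      using l \<sigma>(2) \<tau>(2) by (simp add: l_def)
  qed fact
  then show thesis
    by (rule that)
qed

end

theorem proposition2p4:
  fixes n i :: nat and g :: "'k::field ratfun \<Rightarrow> 'k ratfun"
  assumes "n \<ge> 3" and "i \<le> n - 1" and "g \<in> G_st n"
  shows "(L_s n \<inter> adjoin (K_st n) {g (u_st n i)} = K_st n \<and>
          L_t n \<inter> adjoin (K_st n) {g (u_st n i)} = K_st n) \<and>
         (adjoin (L_s n) (L_t n) = adjoin (L_s n) {g (u_st n i)} \<and>
          adjoin (L_s n) (L_t n) = adjoin (L_t n) {g (u_st n i)})"
proof -
  obtain \<rho> where "permuted_solution n \<rho> (\<lambda>j. g (u_st n j))"
    using G_st_permuted_solution[OF assms(3,1)] .
  then interpret permuted_solution n \<rho> "\<lambda>j. g (u_st n j)" .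
  have "i < n"
    using assms(1,2) by simp
  then show ?thesis
    using L_s_inter L_t_inter adjoin_L_s adjoin_L_t by (simp add: kxy_eq[symmetric])
qed

end
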